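(* Let $K$ be a field, $(E,w)$ a weighted graph and $(F,\phi)$ a representation graph for $(E,w)$. Put $X=F^0$; for $v\in E^0$ put $D_v=(\phi^0)^{-1}(v)$; for $e_i\in\hat E^1$ put $$R_{e_i}=\{u\in D_{s(e)}\mid \exists f\in s_F^{-1}(u):\phi^1(f)=e_i\},\qquad D_{e_i}=\{u\in D_{r(e)}\mid\exists f\in r_F^{-1}(u):\phi^1(f)=e_i\},$$ and let $g_{e_i}:R_{e_i}\to D_{e_i}\subseteq D_{r(e)}$ be given by $g_{e_i}(u)=r_F(f)$, where $f$ is the unique edge in $s_F^{-1}(u)$ with $\phi^1(f)=e_i$. Then $(X,\{R_{e_i}\},\{D_v\},\{g_{e_i}\})$ is an $(E,w)$-branching system. Moreover, the right $L_K(E)$-module induced by this branching system on the space $M_0$ of functions $X\to K$ with finite support is isomorphic to the module $V_F$ defined by $(F,\phi)$.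
   Context: Graphs: a directed graph $E=(E^0,E^1,r,s)$ consists of sets $E^0,E^1$ and maps $r,s:E^1\to E^0$ (range, source). All graphs are row-finite ($s^{-1}(v)$ finite for every vertex $v$). A weighted graph $(E,w)$ is such a graph with a map $w:E^1\to\mathbb N=\{1,2,\dots\}$. For $v\in E^0$, $w(v)=\max\{w(e)\mid e\in s^{-1}(v)\}$, and $w(v)=0$ if $v$ is a sink. The directed graph $\hat E$ has $\hat E^0=E^0$, $\hat E^1=\{e_1,\dots,e_{w(e)}\mid e\in E^1\}$, $\hat s(e_i)=s(e)$, $\hat r(e_i)=r(e)$; $\mathrm{tag}(e_i)=i$, $\mathrm{st}(e_i)=e$. A representation graph of $E$ is a pair $(F,\phi)$, $F$ a directed graph and $\phi=(\phi^0,\phi^1):F\to\hat E$ a homomorphism of directed graphs, such that (1) for any $v\in F^0$ and $1\le i\le w(\phi^0(v))$ there is precisely one $f\in s_F^{-1}(v)$ with $\mathrm{tag}(\phi^1(f))=i$; (2) for any $v\in F^0$ and $e\in r^{-1}(\phi^0(v))$ there is precisely one $f\in r_F^{-1}(v)$ with $\mathrm{st}(\phi^1(f))=e$. Algebra: $L_K(E)=L_K(E,w)$ is the (not necessarily unital) $K$-algebra generated by $\{v,e_i,e_i^*\mid v\in E^0,e\in E^1,1\le i\le w(e)\}$ subject to: $uv=\delta_{uv}u$ for $u,v\in E^0$; $s(e)e_i=e_i=e_ir(e)$, $r(e)e_i^*=e_i^*=e_i^*s(e)$; $\sum_{1\le i\le w(v)}e_i^*f_i=\delta_{ef}r(e)$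 for $v\in E^0$, $e,f\in s^{-1}(v)$; $\sum_{e\in s^{-1}(v)}e_ie_j^*=\delta_{ij}v$ for $v\in E^0$, $1\le i,j\le w(v)$; in the last two, $e_i=e_i^*=0$ if $i>w(e)$. Module $V_F$: the $K$-vector space with basis $F^0$ and right $L_K(E)$-action determined, for $v\in F^0$, by: $v\cdot u=v$ if $\phi^0(v)=u$ and $0$ otherwise ($u\in E^0$); $v\cdot e_i=r_F(f)$ if there is $f\in s_F^{-1}(v)$ with $\phi^1(f)=e_i$, and $0$ otherwise; $v\cdot e_i^*=s_F(f)$ if there is $f\in r_F^{-1}(v)$ with $\phi^1(f)=e_i$, and $0$ otherwise. Branching systems: an $(E,w)$-branching system $(X,\{R_{e_i}\},\{D_v\},\{g_{e_i}\})$ consists of a set $X$, families of subsets $\{R_{e_i}\mid e_i\in\hat E^1\}$ and $\{D_v\mid v\in E^0\}$ of $X$, and injections $g_{e_i}:R_{e_i}\to D_{r(e)}$ such that (1) $\{D_v\}_{v\in E^0}$ is a partition of $X$; (2) for each $v\in E^0$ and $1\le i\le w(v)$, $\{R_{e_i}\mid e\in s^{-1}(v),w(e)\ge i\}$ is a partition of $D_v$; (3) with $D_{e_i}:=g_{e_i}(R_{e_i})$, for each $e\in E^1$ the family $\{D_{e_i}\mid1\le i\le w(e)\}$ is a partition of $D_{r(e)}$. Partition means pairwise disjoint family with the given union; empty members are allowed. The induced right $L_K(E)$-action on functions $\theta:X\to K$ (preserving finite support) is: $\theta.e_i$ is the function equal to $\theta\circ g_{e_i}^{-1}$ on $D_{e_i}$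 and $0$ elsewhere; $\theta.e_i^*$ is equal to $\theta\circ g_{e_i}$ on $R_{e_i}$ and $0$ elsewhere; $\theta.v$ is equal to $\theta$ on $D_v$ and $0$ elsewhere. *)

theory Defs
  imports
    Complex_Main
    "HOL-Library.Poly_Mapping"
    "HOL-Library.Function_Algebras"
    "HOL-Library.Disjoint_Sets"
    "Graph_Theory.Digraph"
begin

section \<open>Weighted graphs and representation graphs\<close>

definition row_finite :: "('v,'e) pre_digraph \<Rightarrow> bool" where
  "row_finite G \<longleftrightarrow> (\<forall>v\<in>verts G. finite (out_arcs G v))"

locale weighted_graph = wf_digraph E for E :: "('v,'e) pre_digraph" +
  fixes w :: "'e \<Rightarrow> nat"
  assumes row_finite: "row_finite E"
    and weight_pos: "e \<in> arcs E \<Longrightarrow> 1 \<le> w e"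

definition vertex_weight :: "('v,'e) pre_digraph \<Rightarrow> ('e \<Rightarrow> nat) \<Rightarrow> 'v \<Rightarrow> nat" where
  "vertex_weight E w v = (if out_arcs E v = {} then 0 else Max (w ` out_arcs E v))"

text \<open>The edge \<open>e\<^sub>i\<close> of the associated unweighted graph is the pair \<open>(e, i)\<close>.\<close>

definition hat_graph :: "('v,'e) pre_digraph \<Rightarrow> ('e \<Rightarrow> nat) \<Rightarrow> ('v, 'e \<times> nat) pre_digraph" where
  "hat_graph E w = \<lparr> verts = verts E,
                     arcs = {(e,i). e \<in> arcs E \<and> 1 \<le> i \<and> i \<le> w e},
                     tail = (\<lambda>(e,i). tail E e),
                     head = (\<lambda>(e,i). head E e) \<rparr>"

abbreviation st :: "'e \<times> nat \<Rightarrow> 'e" where "st \<equiv> fst"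
abbreviation tag :: "'e \<times> nat \<Rightarrow> nat" where "tag \<equiv> snd"

definition graph_hom ::
  "('x,'f) pre_digraph \<Rightarrow> ('v,'a) pre_digraph \<Rightarrow> ('x \<Rightarrow> 'v) \<Rightarrow> ('f \<Rightarrow> 'a) \<Rightarrow> bool" where
  "graph_hom F G \<phi>0 \<phi>1 \<longleftrightarrow>
     (\<forall>v\<in>verts F. \<phi>0 v \<in> verts G) \<and>
     (\<forall>f\<in>arcs F. \<phi>1 f \<in> arcs G \<and>
        tail G (\<phi>1 f) = \<phi>0 (tail F f) \<and> head G (\<phi>1 f) = \<phi>0 (head F f))"

definition representation_graph ::
  "('v,'e) pre_digraph \<Rightarrow> ('e \<Rightarrow> nat) \<Rightarrow> ('x,'f) pre_digraph \<Rightarrow> ('x \<Rightarrow> 'v) \<Rightarrow> ('f \<Rightarrow> 'e \<times> nat) \<Rightarrow> bool"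
where
  "representation_graph E w F \<phi>0 \<phi>1 \<longleftrightarrow>
     wf_digraph F \<and> row_finite F \<and> graph_hom F (hat_graph E w) \<phi>0 \<phi>1 \<and>
     (\<forall>v\<in>verts F. \<forall>i\<in>{1..vertex_weight E w (\<phi>0 v)}. \<exists>!f. f \<in> out_arcs F v \<and> tag (\<phi>1 f) = i) \<and>
     (\<forall>v\<in>verts F. \<forall>e\<in>in_arcs E (\<phi>0 v). \<exists>!f. f \<in> in_arcs F v \<and> st (\<phi>1 f) = e)"


section \<open>Non-unital algebras and right modules\<close>

record ('k,'a) algebra_ops =
  elems :: "'a set"
  alg_zero :: 'a
  alg_add :: "'a \<Rightarrow> 'a \<Rightarrow> 'a"
  alg_scale :: "'k \<Rightarrow> 'a \<Rightarrow> 'a"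
  alg_mult :: "'a \<Rightarrow> 'a \<Rightarrow> 'a"

locale nonunital_algebra =
  fixes A :: "('k::field,'a) algebra_ops"
  assumes zero_closed: "alg_zero A \<in> elems A"
    and add_closed: "\<lbrakk>a \<in> elems A; b \<in> elems A\<rbrakk> \<Longrightarrow> alg_add A a b \<in> elems A"
    and scale_closed: "a \<in> elems A \<Longrightarrow> alg_scale A k a \<in> elems A"
    and mult_closed: "\<lbrakk>a \<in> elems A; b \<in> elems A\<rbrakk> \<Longrightarrow> alg_mult A a b \<in> elems A"
    and add_assoc: "\<lbrakk>a \<in> elems A; b \<in> elems A; c \<in> elems A\<rbrakk> \<Longrightarrow>
          alg_add A (alg_add A a b) c = alg_add A a (alg_add A b c)"
    and add_comm: "\<lbrakk>a \<in> elems A; b \<in> elems A\<rbrakk> \<Longrightarrow> alg_add A a b = alg_add A b a"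
    and add_zero: "a \<in> elems A \<Longrightarrow> alg_add A (alg_zero A) a = a"
    and add_inverse: "a \<in> elems A \<Longrightarrow> \<exists>b\<in>elems A. alg_add A a b = alg_zero A"
    and scale_add: "\<lbrakk>a \<in> elems A; b \<in> elems A\<rbrakk> \<Longrightarrow>
          alg_scale A k (alg_add A a b) = alg_add A (alg_scale A k a) (alg_scale A k b)"
    and add_scale: "a \<in> elems A \<Longrightarrow>
          alg_scale A (k + l) a = alg_add A (alg_scale A k a) (alg_scale A l a)"
    and scale_scale: "a \<in> elems A \<Longrightarrow> alg_scale A k (alg_scale A l a) = alg_scale A (k * l) a"
    and scale_one: "a \<in> elems A \<Longrightarrow> alg_scale A 1 a = a"
    and mult_assoc: "\<lbrakk>a \<in> elems A; b \<in> elems A; c \<in> elems A\<rbrakk> \<Longrightarrow>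
          alg_mult A (alg_mult A a b) c = alg_mult A a (alg_mult A b c)"
    and add_mult: "\<lbrakk>a \<in> elems A; b \<in> elems A; c \<in> elems A\<rbrakk> \<Longrightarrow>
          alg_mult A (alg_add A a b) c = alg_add A (alg_mult A a c) (alg_mult A b c)"
    and mult_add: "\<lbrakk>a \<in> elems A; b \<in> elems A; c \<in> elems A\<rbrakk> \<Longrightarrow>
          alg_mult A a (alg_add A b c) = alg_add A (alg_mult A a b) (alg_mult A a c)"
    and scale_mult: "\<lbrakk>a \<in> elems A; b \<in> elems A\<rbrakk> \<Longrightarrow>
          alg_mult A (alg_scale A k a) b = alg_scale A k (alg_mult A a b)"
    and mult_scale: "\<lbrakk>a \<in> elems A; b \<in> elems A\<rbrakk> \<Longrightarrow>
          alg_mult A a (alg_scale A k b) = alg_scale A k (alg_mult A a b)"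

text \<open>A right module is a subspace \<open>M\<close> of an ambient vector space with scalar multiplication
  \<open>sc\<close>, together with an action \<open>act\<close> that is only constrained on \<open>M\<close> and the algebra.\<close>

locale right_module = nonunital_algebra A + vector_space sc
  for A :: "('k::field,'a) algebra_ops"
    and sc :: "'k \<Rightarrow> 'm::ab_group_add \<Rightarrow> 'm"
    and M :: "'m set"
    and act :: "'m \<Rightarrow> 'a \<Rightarrow> 'm" +
  assumes subspace_M: "subspace M"
    and act_closed: "\<lbrakk>m \<in> M; a \<in> elems A\<rbrakk> \<Longrightarrow> act m a \<in> M"
    and act_add_left: "\<lbrakk>m \<in> M; n \<in> M; a \<in> elems A\<rbrakk> \<Longrightarrow> act (m + n) a = act m a + act n a"
    and act_add_right: "\<lbrakk>m \<in> M; a \<in> elems A; b \<in> elems A\<rbrakk> \<Longrightarrow>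
          act m (alg_add A a b) = act m a + act m b"
    and act_scale_left: "\<lbrakk>m \<in> M; a \<in> elems A\<rbrakk> \<Longrightarrow> act (sc k m) a = sc k (act m a)"
    and act_scale_right: "\<lbrakk>m \<in> M; a \<in> elems A\<rbrakk> \<Longrightarrow> act m (alg_scale A k a) = sc k (act m a)"
    and act_mult: "\<lbrakk>m \<in> M; a \<in> elems A; b \<in> elems A\<rbrakk> \<Longrightarrow>
          act m (alg_mult A a b) = act (act m a) b"

definition right_module_iso ::
  "('k::field,'a) algebra_ops \<Rightarrow>
   ('k \<Rightarrow> 'm::ab_group_add \<Rightarrow> 'm) \<Rightarrow> 'm set \<Rightarrow> ('m \<Rightarrow> 'a \<Rightarrow> 'm) \<Rightarrow>
   ('k \<Rightarrow> 'n::ab_group_add \<Rightarrow> 'n) \<Rightarrow> 'n set \<Rightarrow> ('n \<Rightarrow> 'a \<Rightarrow> 'n) \<Rightarrow> ('m \<Rightarrow> 'n) \<Rightarrow> bool" where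
  "right_module_iso A sc M act sc' N act' h \<longleftrightarrow>
     bij_betw h M N \<and>
     (\<forall>m\<in>M. \<forall>n\<in>M. h (m + n) = h m + h n) \<and>
     (\<forall>k. \<forall>m\<in>M. h (sc k m) = sc' k (h m)) \<and>
     (\<forall>m\<in>M. \<forall>a\<in>elems A. h (act m a) = act' (h m) a)"


section \<open>Algebras given by generators and relations\<close>

text \<open>Words are wrapped lists, so that they can be made an instance of the class of (additively
  written) monoids; finitely supported functions on words then form the free unital algebra.
  The free non-unital algebra is the subspace spanned by the nonempty words.\<close>

datatype 'g fword = FWord (letters: "'g list")

instantiation fword :: (type) monoid_add
begin
definition zero_fword :: "'g fword" where "zero_fword = FWord []"
definition plus_fword :: "'g fword \<Rightarrow> 'g fword \<Rightarrow> 'g fword" where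
  "plus_fword u v = FWord (letters u @ letters v)"
instance by standard (simp_all add: zero_fword_def plus_fword_def)
end

definition pm_scale :: "'k::field \<Rightarrow> ('x \<Rightarrow>\<^sub>0 'k) \<Rightarrow> ('x \<Rightarrow>\<^sub>0 'k)" where
  "pm_scale k p = Poly_Mapping.map ((*) k) p"

definition free_elems :: "'g set \<Rightarrow> ('g fword \<Rightarrow>\<^sub>0 'k::field) set" where
  "free_elems S = {p. \<forall>u\<in>Poly_Mapping.keys p. letters u \<noteq> [] \<and> set (letters u) \<subseteq> S}"

definition free_gen :: "'g \<Rightarrow> ('g fword \<Rightarrow>\<^sub>0 'k::field)" where
  "free_gen x = Poly_Mapping.single (FWord [x]) 1"

inductive_set rel_ideal :: "'g set \<Rightarrow> ('g fword \<Rightarrow>\<^sub>0 'k::field) set \<Rightarrow> ('g fword \<Rightarrow>\<^sub>0 'k) set"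
  for S :: "'g set" and Rl :: "('g fword \<Rightarrow>\<^sub>0 'k) set" where
  zero: "0 \<in> rel_ideal S Rl"
| rel: "p \<in> Rl \<Longrightarrow> p \<in> rel_ideal S Rl"
| add: "\<lbrakk>p \<in> rel_ideal S Rl; q \<in> rel_ideal S Rl\<rbrakk> \<Longrightarrow> p + q \<in> rel_ideal S Rl"
| scale: "p \<in> rel_ideal S Rl \<Longrightarrow> pm_scale k p \<in> rel_ideal S Rl"
| mult_left: "\<lbrakk>a \<in> free_elems S; p \<in> rel_ideal S Rl\<rbrakk> \<Longrightarrow> a * p \<in> rel_ideal S Rl"
| mult_right: "\<lbrakk>p \<in> rel_ideal S Rl; a \<in> free_elems S\<rbrakk> \<Longrightarrow> p * a \<in> rel_ideal S Rl"

definition rel_class ::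
  "'g set \<Rightarrow> ('g fword \<Rightarrow>\<^sub>0 'k::field) set \<Rightarrow> ('g fword \<Rightarrow>\<^sub>0 'k) \<Rightarrow> ('g fword \<Rightarrow>\<^sub>0 'k) set" where
  "rel_class S Rl a = {b \<in> free_elems S. b - a \<in> rel_ideal S Rl}"

definition presented_algebra ::
  "'g set \<Rightarrow> ('g fword \<Rightarrow>\<^sub>0 'k::field) set \<Rightarrow> ('k, ('g fword \<Rightarrow>\<^sub>0 'k) set) algebra_ops" where
  "presented_algebra S Rl = \<lparr>
     elems = rel_class S Rl ` free_elems S,
     alg_zero = rel_class S Rl 0,
     alg_add = (\<lambda>X Y. \<Union>a\<in>X. \<Union>b\<in>Y. rel_class S Rl (a + b)),
     alg_scale = (\<lambda>k X. \<Union>a\<in>X. rel_class S Rl (pm_scale k a)),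
     alg_mult = (\<lambda>X Y. \<Union>a\<in>X. \<Union>b\<in>Y. rel_class S Rl (a * b)) \<rparr>"

text \<open>Extension of the action \<open>ga\<close> of the generators to the free algebra and to its quotient.
  The latter is meaningful only if all representatives of a class act in the same way.\<close>

definition free_act ::
  "('k::field \<Rightarrow> 'm::ab_group_add \<Rightarrow> 'm) \<Rightarrow> ('m \<Rightarrow> 'g \<Rightarrow> 'm) \<Rightarrow> 'm \<Rightarrow> ('g fword \<Rightarrow>\<^sub>0 'k) \<Rightarrow> 'm" where
  "free_act sc ga m p = (\<Sum>u\<in>Poly_Mapping.keys p. sc (Poly_Mapping.lookup p u) (foldl ga m (letters u)))"

definition quot_act ::
  "('k::field \<Rightarrow> 'm::ab_group_add \<Rightarrow> 'm) \<Rightarrow> ('m \<Rightarrow> 'g \<Rightarrow> 'm) \<Rightarrow> 'm \<Rightarrow> ('g fword \<Rightarrow>\<^sub>0 'k) set \<Rightarrow> 'm" where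
  "quot_act sc ga m X = the_elem (free_act sc ga m ` X)"


subsection \<open>The operations on classes are well defined\<close>

lemma pm_scale_conv: "pm_scale k (p :: 'g::monoid_add \<Rightarrow>\<^sub>0 'k::field) = Poly_Mapping.single 0 k * p"
  by (simp add: pm_scale_def mult_map_scale_conv_mult)

lemma lookup_pm_scale: "Poly_Mapping.lookup (pm_scale k p) u = k * Poly_Mapping.lookup p u"
  by (simp add: pm_scale_def Poly_Mapping.map.rep_eq when_def)

lemma pm_scale_add: "pm_scale k (p + q) = pm_scale k p + pm_scale k q"
  by (rule poly_mapping_eqI) (simp add: lookup_pm_scale lookup_add algebra_simps)

lemma pm_scale_diff: "pm_scale k (p - q) = pm_scale k p - pm_scale k q"
  by (rule poly_mapping_eqI) (simp add: lookup_pm_scale lookup_minus algebra_simps)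

lemma pm_scale_add_left: "pm_scale (k + l) p = pm_scale k p + pm_scale l p"
  by (rule poly_mapping_eqI) (simp add: lookup_pm_scale lookup_add algebra_simps)

lemma pm_scale_scale: "pm_scale k (pm_scale l p) = pm_scale (k * l) p"
  by (rule poly_mapping_eqI) (simp add: lookup_pm_scale algebra_simps)

lemma pm_scale_one: "pm_scale 1 p = p"
  by (rule poly_mapping_eqI) (simp add: lookup_pm_scale)

lemma pm_scale_minus_one: "pm_scale (- 1) p = - p"
  by (rule poly_mapping_eqI) (simp add: lookup_pm_scale)

lemma pm_scale_mult_left: "pm_scale k p * q = pm_scale k (p * q :: 'g::monoid_add \<Rightarrow>\<^sub>0 'k::field)"
  by (simp add: pm_scale_conv mult.assoc)

lemma pm_single_commute:
  fixes p :: "'g::monoid_add \<Rightarrow>\<^sub>0 'k::field"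
  shows "Poly_Mapping.single 0 k * p = p * Poly_Mapping.single 0 k"
proof (induction p rule: Poly_Mapping.update_induct)
  case const
  show ?case by simp
next
  case (update p u c)
  have "Poly_Mapping.update u c p = p + Poly_Mapping.single u c"
    using update(1)
    by (intro poly_mapping_eqI) (auto simp: lookup_update lookup_add lookup_single in_keys_iff when_def)
  then show ?case using update by (simp add: distrib_left distrib_right mult_single mult.commute)
qed

lemma pm_scale_mult_right: "p * pm_scale k q = pm_scale k (p * q :: 'g::monoid_add \<Rightarrow>\<^sub>0 'k::field)"
  by (simp add: pm_scale_conv flip: mult.assoc) (simp add: pm_single_commute)

lemma free_elems_zero: "0 \<in> free_elems S"
  by (simp add: free_elems_def)

lemma free_elems_add: "\<lbrakk>p \<in> free_elems S; q \<in> free_elems S\<rbrakk> \<Longrightarrow> p + q \<in> free_elems S"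
  using Poly_Mapping.keys_add[of p q] by (auto simp: free_elems_def)

lemma free_elems_scale: "p \<in> free_elems S \<Longrightarrow> pm_scale k p \<in> free_elems S"
  by (auto simp: free_elems_def in_keys_iff lookup_pm_scale)

lemma free_elems_mult: "\<lbrakk>p \<in> free_elems S; q \<in> free_elems S\<rbrakk> \<Longrightarrow> p * q \<in> free_elems S"
  using keys_mult[of p q] by (fastforce simp: free_elems_def plus_fword_def)

lemma free_gen_in: "x \<in> S \<Longrightarrow> free_gen x \<in> free_elems S"
  by (auto simp: free_elems_def free_gen_def)

lemma rel_ideal_uminus: "p \<in> rel_ideal S Rl \<Longrightarrow> - p \<in> rel_ideal S Rl"
  using rel_ideal.scale[of p S Rl "- 1"] by (simp add: pm_scale_minus_one)

lemma rel_ideal_diff: "\<lbrakk>p \<in> rel_ideal S Rl; q \<in> rel_ideal S Rl\<rbrakk> \<Longrightarrow> p - q \<in> rel_ideal S Rl"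
  using rel_ideal.add[of p S Rl "- q"] rel_ideal_uminus[of q S Rl] by simp

lemma rel_class_self: "a \<in> free_elems S \<Longrightarrow> a \<in> rel_class S Rl a"
  by (simp add: rel_class_def rel_ideal.zero)

lemma rel_class_cong:
  assumes "a - b \<in> rel_ideal S Rl"
  shows "rel_class S Rl a = rel_class S Rl b"
proof -
  have "c - a \<in> rel_ideal S Rl \<longleftrightarrow> c - b \<in> rel_ideal S Rl" for c
  proof
    assume "c - a \<in> rel_ideal S Rl"
    from rel_ideal.add[OF this assms] show "c - b \<in> rel_ideal S Rl" by simp
  next
    assume "c - b \<in> rel_ideal S Rl"
    from rel_ideal_diff[OF this assms] show "c - a \<in> rel_ideal S Rl" by simp
  qed
  then show ?thesis by (simp add: rel_class_def)
qed

lemma UN_eq_if_const: "\<lbrakk>x \<in> X; \<And>y. y \<in> X \<Longrightarrow> P y = Z\<rbrakk> \<Longrightarrow> (\<Union>y\<in>X. P y) = Z"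
  by blast

lemma presented_add:
  assumes "a \<in> free_elems S" "b \<in> free_elems S"
  shows "alg_add (presented_algebra S Rl) (rel_class S Rl a) (rel_class S Rl b) = rel_class S Rl (a + b)"
proof -
  have "rel_class S Rl (a' + b') = rel_class S Rl (a + b)"
    if "a' \<in> rel_class S Rl a" "b' \<in> rel_class S Rl b" for a' b'
  proof (rule rel_class_cong)
    have "(a' - a) + (b' - b) \<in> rel_ideal S Rl"
      using that by (auto simp: rel_class_def intro: rel_ideal.add)
    then show "a' + b' - (a + b) \<in> rel_ideal S Rl" by (simp add: add_diff_add)
  qed
  moreover have "a \<in> rel_class S Rl a" "b \<in> rel_class S Rl b"
    using assms by (simp_all add: rel_class_self)
  ultimately show ?thesis
    unfolding presented_algebra_def algebra_ops.simps by (intro UN_eq_if_const)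
qed

lemma presented_scale:
  assumes "a \<in> free_elems S"
  shows "alg_scale (presented_algebra S Rl) k (rel_class S Rl a) = rel_class S Rl (pm_scale k a)"
proof -
  have "rel_class S Rl (pm_scale k a') = rel_class S Rl (pm_scale k a)"
    if "a' \<in> rel_class S Rl a" for a'
    using that rel_ideal.scale[of "a' - a" S Rl k]
    by (intro rel_class_cong) (simp add: rel_class_def pm_scale_diff)
  moreover have "a \<in> rel_class S Rl a"
    using assms by (simp_all add: rel_class_self)
  ultimately show ?thesis
    unfolding presented_algebra_def algebra_ops.simps by (intro UN_eq_if_const)
qed

lemma presented_mult:
  assumes "a \<in> free_elems S" "b \<in> free_elems S"
  shows "alg_mult (presented_algebra S Rl) (rel_class S Rl a) (rel_class S Rl b) = rel_class S Rl (a * b)"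
proof -
  have "rel_class S Rl (a' * b') = rel_class S Rl (a * b)"
    if "a' \<in> rel_class S Rl a" "b' \<in> rel_class S Rl b" for a' b'
  proof (rule rel_class_cong)
    have "(a' - a) * b' + a * (b' - b) \<in> rel_ideal S Rl"
      using that assms by (auto simp: rel_class_def intro: rel_ideal.intros)
    then show "a' * b' - a * b \<in> rel_ideal S Rl" by (simp add: left_diff_distrib right_diff_distrib)
  qed
  moreover have "a \<in> rel_class S Rl a" "b \<in> rel_class S Rl b"
    using assms by (simp_all add: rel_class_self)
  ultimately show ?thesis
    unfolding presented_algebra_def algebra_ops.simps by (intro UN_eq_if_const)
qed

lemma elems_presented: "elems (presented_algebra S Rl) = rel_class S Rl ` free_elems S"
  by (simp add: presented_algebra_def)

lemma zero_presented: "alg_zero (presented_algebra S Rl) = rel_class S Rl 0"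
  by (simp add: presented_algebra_def)

lemma presented_inverse:
  assumes "a \<in> free_elems S"
  shows "alg_add (presented_algebra S Rl) (rel_class S Rl a) (rel_class S Rl (pm_scale (- 1) a))
           = rel_class S Rl 0"
  using assms by (simp add: presented_add free_elems_scale) (simp add: pm_scale_minus_one)

lemma rel_class_in: "a \<in> free_elems S \<Longrightarrow> rel_class S Rl a \<in> elems (presented_algebra S Rl)"
  by (simp add: elems_presented)

lemma elems_presentedE:
  assumes "X \<in> elems (presented_algebra S Rl)"
  obtains a where "a \<in> free_elems S" "X = rel_class S Rl a"
  using assms by (auto simp: elems_presented)

lemma nonunital_algebra_presented: "nonunital_algebra (presented_algebra S Rl)"
proof -
  note closed = free_elems_zero free_elems_add free_elems_scale free_elems_mult
  note ops = zero_presented presented_add presented_scale presented_mult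
  show ?thesis
  proof (unfold_locales, goal_cases)
    case 8
    then show ?case
      using presented_inverse free_elems_scale rel_class_in
      by (metis elems_presentedE zero_presented)
  qed ((elim elems_presentedE)?, simp add: ops closed rel_class_in add.assoc add.commute add.left_commute
         pm_scale_add pm_scale_add_left pm_scale_scale pm_scale_one mult.assoc
         pm_scale_mult_left pm_scale_mult_right distrib_left distrib_right)+
qed


section \<open>The weighted Leavitt path algebra\<close>

datatype ('v,'e) lpa_gen = Vertex 'v | Edge 'e nat | Ghost 'e nat

definition lpa_gens :: "('v,'e) pre_digraph \<Rightarrow> ('e \<Rightarrow> nat) \<Rightarrow> ('v,'e) lpa_gen set" where
  "lpa_gens E w = {Vertex v | v. v \<in> verts E} \<union>
     {Edge e i | e i. e \<in> arcs E \<and> 1 \<le> i \<and> i \<le> w e} \<union>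
     {Ghost e i | e i. e \<in> arcs E \<and> 1 \<le> i \<and> i \<le> w e}"

text \<open>\<open>e\<^sub>i\<close> and \<open>e\<^sub>i\<^sup>*\<close>, read as zero when \<open>i > w(e)\<close>.\<close>

definition edge_elt :: "('e \<Rightarrow> nat) \<Rightarrow> 'e \<Rightarrow> nat \<Rightarrow> (('v,'e) lpa_gen fword \<Rightarrow>\<^sub>0 'k::field)" where
  "edge_elt w e i = (if i \<le> w e then free_gen (Edge e i) else 0)"

definition ghost_elt :: "('e \<Rightarrow> nat) \<Rightarrow> 'e \<Rightarrow> nat \<Rightarrow> (('v,'e) lpa_gen fword \<Rightarrow>\<^sub>0 'k::field)" where
  "ghost_elt w e i = (if i \<le> w e then free_gen (Ghost e i) else 0)"

abbreviation vertex_elt :: "'v \<Rightarrow> (('v,'e) lpa_gen fword \<Rightarrow>\<^sub>0 'k::field)" where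
  "vertex_elt v \<equiv> free_gen (Vertex v)"

text \<open>A relation \<open>p = q\<close> is represented by the element \<open>p - q\<close>.\<close>

inductive_set lpa_rels ::
  "('v,'e) pre_digraph \<Rightarrow> ('e \<Rightarrow> nat) \<Rightarrow> (('v,'e) lpa_gen fword \<Rightarrow>\<^sub>0 'k::field) set"
  for E :: "('v,'e) pre_digraph" and w :: "'e \<Rightarrow> nat" where
  vertices: "\<lbrakk>u \<in> verts E; v \<in> verts E\<rbrakk> \<Longrightarrow>
    vertex_elt u * vertex_elt v - (if u = v then vertex_elt u else 0) \<in> lpa_rels E w"
| edge_source: "\<lbrakk>e \<in> arcs E; 1 \<le> i; i \<le> w e\<rbrakk> \<Longrightarrow>
    vertex_elt (tail E e) * edge_elt w e i - edge_elt w e i \<in> lpa_rels E w"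
| edge_range: "\<lbrakk>e \<in> arcs E; 1 \<le> i; i \<le> w e\<rbrakk> \<Longrightarrow>
    edge_elt w e i * vertex_elt (head E e) - edge_elt w e i \<in> lpa_rels E w"
| ghost_range: "\<lbrakk>e \<in> arcs E; 1 \<le> i; i \<le> w e\<rbrakk> \<Longrightarrow>
    vertex_elt (head E e) * ghost_elt w e i - ghost_elt w e i \<in> lpa_rels E w"
| ghost_source: "\<lbrakk>e \<in> arcs E; 1 \<le> i; i \<le> w e\<rbrakk> \<Longrightarrow>
    ghost_elt w e i * vertex_elt (tail E e) - ghost_elt w e i \<in> lpa_rels E w"
| ghost_edge: "\<lbrakk>v \<in> verts E; e \<in> out_arcs E v; f \<in> out_arcs E v\<rbrakk> \<Longrightarrow>
    (\<Sum>i = 1..vertex_weight E w v. ghost_elt w e i * edge_elt w f i)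
      - (if e = f then vertex_elt (head E e) else 0) \<in> lpa_rels E w"
| edge_ghost: "\<lbrakk>v \<in> verts E; i \<in> {1..vertex_weight E w v}; j \<in> {1..vertex_weight E w v}\<rbrakk> \<Longrightarrow>
    (\<Sum>e\<in>out_arcs E v. edge_elt w e i * ghost_elt w e j)
      - (if i = j then vertex_elt v else 0) \<in> lpa_rels E w"

abbreviation lpa ::
  "('v,'e) pre_digraph \<Rightarrow> ('e \<Rightarrow> nat) \<Rightarrow>
   ('k::field, (('v,'e) lpa_gen fword \<Rightarrow>\<^sub>0 'k) set) algebra_ops" where
  "lpa E w \<equiv> presented_algebra (lpa_gens E w) (lpa_rels E w)"

definition lpa_gen_elt ::
  "('v,'e) pre_digraph \<Rightarrow> ('e \<Rightarrow> nat) \<Rightarrow> ('v,'e) lpa_gen \<Rightarrow>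
   (('v,'e) lpa_gen fword \<Rightarrow>\<^sub>0 'k::field) set" where
  "lpa_gen_elt E w x = rel_class (lpa_gens E w) (lpa_rels E w) (free_gen x)"


section \<open>The module of a representation graph\<close>

text \<open>\<open>V\<^sub>F\<close> consists of the finitely supported functions on the vertices of \<open>F\<close>, a vertex \<open>v\<close>
  being identified with \<open>single v 1\<close>.\<close>

definition VF_space :: "('x,'f) pre_digraph \<Rightarrow> ('x \<Rightarrow>\<^sub>0 'k::field) set" where
  "VF_space F = {p. Poly_Mapping.keys p \<subseteq> verts F}"

fun VF_basis_act ::
  "('x,'f) pre_digraph \<Rightarrow> ('x \<Rightarrow> 'v) \<Rightarrow> ('f \<Rightarrow> 'e \<times> nat) \<Rightarrow> 'x \<Rightarrow> ('v,'e) lpa_gen \<Rightarrow> ('x \<Rightarrow>\<^sub>0 'k::field)"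
where
  "VF_basis_act F \<phi>0 \<phi>1 v (Vertex u) = (if \<phi>0 v = u then Poly_Mapping.single v 1 else 0)"
| "VF_basis_act F \<phi>0 \<phi>1 v (Edge e i) =
     (if \<exists>f\<in>out_arcs F v. \<phi>1 f = (e,i)
      then Poly_Mapping.single (head F (THE f. f \<in> out_arcs F v \<and> \<phi>1 f = (e,i))) 1 else 0)"
| "VF_basis_act F \<phi>0 \<phi>1 v (Ghost e i) =
     (if \<exists>f\<in>in_arcs F v. \<phi>1 f = (e,i)
      then Poly_Mapping.single (tail F (THE f. f \<in> in_arcs F v \<and> \<phi>1 f = (e,i))) 1 else 0)"

definition VF_gen_act ::
  "('x,'f) pre_digraph \<Rightarrow> ('x \<Rightarrow> 'v) \<Rightarrow> ('f \<Rightarrow> 'e \<times> nat) \<Rightarrow>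
   ('x \<Rightarrow>\<^sub>0 'k::field) \<Rightarrow> ('v,'e) lpa_gen \<Rightarrow> ('x \<Rightarrow>\<^sub>0 'k)" where
  "VF_gen_act F \<phi>0 \<phi>1 p x =
     (\<Sum>v\<in>Poly_Mapping.keys p. pm_scale (Poly_Mapping.lookup p v) (VF_basis_act F \<phi>0 \<phi>1 v x))"

definition VF_act ::
  "('x,'f) pre_digraph \<Rightarrow> ('x \<Rightarrow> 'v) \<Rightarrow> ('f \<Rightarrow> 'e \<times> nat) \<Rightarrow>
   ('x \<Rightarrow>\<^sub>0 'k::field) \<Rightarrow> (('v,'e) lpa_gen fword \<Rightarrow>\<^sub>0 'k) set \<Rightarrow> ('x \<Rightarrow>\<^sub>0 'k)" where
  "VF_act F \<phi>0 \<phi>1 = quot_act pm_scale (VF_gen_act F \<phi>0 \<phi>1)"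


section \<open>Branching systems\<close>

definition partition_family :: "('i \<Rightarrow> 'x set) \<Rightarrow> 'i set \<Rightarrow> 'x set \<Rightarrow> bool" where
  "partition_family P I Y \<longleftrightarrow> disjoint_family_on P I \<and> (\<Union>i\<in>I. P i) = Y"

definition branching_system ::
  "('v,'e) pre_digraph \<Rightarrow> ('e \<Rightarrow> nat) \<Rightarrow> 'x set \<Rightarrow> ('e \<times> nat \<Rightarrow> 'x set) \<Rightarrow> ('v \<Rightarrow> 'x set) \<Rightarrow>
   ('e \<times> nat \<Rightarrow> 'x \<Rightarrow> 'x) \<Rightarrow> bool" where
  "branching_system E w X R D g \<longleftrightarrow>
     (\<forall>a\<in>arcs (hat_graph E w). R a \<subseteq> X) \<and>
     (\<forall>v\<in>verts E. D v \<subseteq> X) \<and>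
     (\<forall>a\<in>arcs (hat_graph E w). inj_on (g a) (R a) \<and> g a ` R a \<subseteq> D (head E (st a))) \<and>
     partition_family D (verts E) X \<and>
     (\<forall>v\<in>verts E. \<forall>i\<in>{1..vertex_weight E w v}.
        partition_family (\<lambda>e. R (e,i)) {e \<in> out_arcs E v. i \<le> w e} (D v)) \<and>
     (\<forall>e\<in>arcs E. partition_family (\<lambda>i. g (e,i) ` R (e,i)) {1..w e} (D (head E e)))"

text \<open>Functions \<open>X \<rightarrow> K\<close> are represented by functions on the ambient type vanishing outside \<open>X\<close>.\<close>

definition fin_supp_functions :: "'x set \<Rightarrow> ('x \<Rightarrow> 'k::field) set" where
  "fin_supp_functions X = {\<theta>. (\<forall>x. x \<notin> X \<longrightarrow> \<theta> x = 0) \<and> finite {x \<in> X. \<theta> x \<noteq> 0}}"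

definition fun_scale :: "'k::field \<Rightarrow> ('x \<Rightarrow> 'k) \<Rightarrow> ('x \<Rightarrow> 'k)" where
  "fun_scale k \<theta> = (\<lambda>x. k * \<theta> x)"

fun branching_gen_act ::
  "('e \<times> nat \<Rightarrow> 'x set) \<Rightarrow> ('v \<Rightarrow> 'x set) \<Rightarrow> ('e \<times> nat \<Rightarrow> 'x \<Rightarrow> 'x) \<Rightarrow>
   ('x \<Rightarrow> 'k::field) \<Rightarrow> ('v,'e) lpa_gen \<Rightarrow> ('x \<Rightarrow> 'k)" where
  "branching_gen_act R D g \<theta> (Vertex v) = (\<lambda>x. if x \<in> D v then \<theta> x else 0)"
| "branching_gen_act R D g \<theta> (Edge e i) =
     (\<lambda>x. if x \<in> g (e,i) ` R (e,i) then \<theta> (inv_into (R (e,i)) (g (e,i)) x) else 0)"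
| "branching_gen_act R D g \<theta> (Ghost e i) = (\<lambda>x. if x \<in> R (e,i) then \<theta> (g (e,i) x) else 0)"

definition branching_act ::
  "('e \<times> nat \<Rightarrow> 'x set) \<Rightarrow> ('v \<Rightarrow> 'x set) \<Rightarrow> ('e \<times> nat \<Rightarrow> 'x \<Rightarrow> 'x) \<Rightarrow>
   ('x \<Rightarrow> 'k::field) \<Rightarrow> (('v,'e) lpa_gen fword \<Rightarrow>\<^sub>0 'k) set \<Rightarrow> ('x \<Rightarrow> 'k)" where
  "branching_act R D g = quot_act fun_scale (branching_gen_act R D g)"


section \<open>The branching system of a representation graph\<close>

definition rep_D :: "('x,'f) pre_digraph \<Rightarrow> ('x \<Rightarrow> 'v) \<Rightarrow> 'v \<Rightarrow> 'x set" where
  "rep_D F \<phi>0 v = {u \<in> verts F. \<phi>0 u = v}"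

definition rep_R ::
  "('v,'e) pre_digraph \<Rightarrow> ('x,'f) pre_digraph \<Rightarrow> ('x \<Rightarrow> 'v) \<Rightarrow> ('f \<Rightarrow> 'e \<times> nat) \<Rightarrow> 'e \<times> nat \<Rightarrow> 'x set"
where
  "rep_R E F \<phi>0 \<phi>1 a = {u \<in> rep_D F \<phi>0 (tail E (st a)). \<exists>f\<in>out_arcs F u. \<phi>1 f = a}"

definition rep_De ::
  "('v,'e) pre_digraph \<Rightarrow> ('x,'f) pre_digraph \<Rightarrow> ('x \<Rightarrow> 'v) \<Rightarrow> ('f \<Rightarrow> 'e \<times> nat) \<Rightarrow> 'e \<times> nat \<Rightarrow> 'x set"
where
  "rep_De E F \<phi>0 \<phi>1 a = {u \<in> rep_D F \<phi>0 (head E (st a)). \<exists>f\<in>in_arcs F u. \<phi>1 f = a}"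

definition rep_g :: "('x,'f) pre_digraph \<Rightarrow> ('f \<Rightarrow> 'e \<times> nat) \<Rightarrow> 'e \<times> nat \<Rightarrow> 'x \<Rightarrow> 'x" where
  "rep_g F \<phi>1 a u = head F (THE f. f \<in> out_arcs F u \<and> \<phi>1 f = a)"

end

theory Submission
  imports Defs
begin

text \<open>An edge \<open>f\<close> of \<open>F\<close> is determined by its source together with
  the tag of \<open>\<phi>\<^sup>1(f)\<close>, and also by its range together with the edge of
  \<open>E\<close> below \<open>f\<close>. So the edges of \<open>F\<close> labelled
  \<open>e\<^sub>i\<close> form the graph of an injective partial function on the vertices of
  \<open>F\<close>, namely \<open>g (e, i)\<close>, with domain \<open>R (e, i)\<close> and image
  \<open>De (e, i)\<close> (lemmas \<open>g_graph\<close>, \<open>g_image\<close>). Existence and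
  uniqueness in the two conditions on a representation graph then say precisely that the domains,
  for fixed tag, and the images, for fixed edge of \<open>E\<close>, are partitions as a branching
  system requires (\<open>representation_branching_system\<close>).

  For any branching system, \<open>e\<^sub>i\<close> and \<open>e\<^sub>i\<^sup>*\<close> act on
  functions by transport along \<open>g\<close> and back, with extension by zero. The products in
  the two families of relations that involve sums therefore act as zero or as restriction to a
  member of a partition, and the sums act as zero or as restriction to the partitioned set; the
  remaining relations only say where functions are supported (\<open>lpa_rels_act\<close>). The
  annihilator of the function space is an ideal, so the whole ideal of relations acts as zero and
  the action descends to the quotient algebra (\<open>rel_ideal_annihilates\<close>,
  \<open>right_module_presented\<close>).

  The module \<open>V\<^sub>F\<close> need not be treated separately. The identification of a
  finitely supported function with a formal linear combination of vertices commutes with the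
  generators (\<open>lookup_VF_gen_act\<close>): on a vertex \<open>v\<close>, that is on the
  indicator function of \<open>{v}\<close>, both \<open>e\<^sub>i\<close> actions follow the edge
  labelled \<open>e\<^sub>i\<close> that leaves \<open>v\<close>, and both
  \<open>e\<^sub>i\<^sup>*\<close> actions follow the one that enters \<open>v\<close> backwards.
  Along a linear map commuting with the generators, linearity and relations pass to the image
  (\<open>relation_action_image\<close>), and if the map is injective it is an isomorphism of
  modules (\<open>right_module_iso_image\<close>).\<close>

section \<open>Actions of generators on a vector space\<close>

lemma sum_monomials: "(\<Sum>u\<in>Poly_Mapping.keys p. Poly_Mapping.single u (Poly_Mapping.lookup p u)) = p"
  by (rule poly_mapping_eqI) (simp add: lookup_sum lookup_single when_def in_keys_iff)

context vector_space
begin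

lemma free_act_superset:
  assumes "finite A" "Poly_Mapping.keys p \<subseteq> A"
  shows "free_act scale ga m p = (\<Sum>u\<in>A. scale (Poly_Mapping.lookup p u) (foldl ga m (letters u)))"
  unfolding free_act_def by (rule sum.mono_neutral_left) (use assms in \<open>auto simp: in_keys_iff\<close>)

lemma free_act_zero: "free_act scale ga m 0 = 0"
  by (simp add: free_act_def)

lemma free_act_single:
  "free_act scale ga m (Poly_Mapping.single u c) = scale c (foldl ga m (letters u))"
  by (subst free_act_superset[of "{u}"]) auto

lemma free_act_add: "free_act scale ga m (p + q) = free_act scale ga m p + free_act scale ga m q"
proof -
  let ?A = "Poly_Mapping.keys p \<union> Poly_Mapping.keys q"
  have "free_act scale ga m r = (\<Sum>u\<in>?A. scale (Poly_Mapping.lookup r u) (foldl ga m (letters u)))"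
    if "Poly_Mapping.keys r \<subseteq> ?A" for r
    using that by (intro free_act_superset) auto
  then show ?thesis
    using Poly_Mapping.keys_add[of p q]
    by (simp add: lookup_add scale_left_distrib sum.distrib)
qed

lemma free_act_pm_scale: "free_act scale ga m (pm_scale k p) = scale k (free_act scale ga m p)"
proof -
  have "Poly_Mapping.keys (pm_scale k p) \<subseteq> Poly_Mapping.keys p"
    by (auto simp: in_keys_iff lookup_pm_scale)
  then have "free_act scale ga m (pm_scale k p)
      = (\<Sum>u\<in>Poly_Mapping.keys p. scale (Poly_Mapping.lookup (pm_scale k p) u) (foldl ga m (letters u)))"
    by (intro free_act_superset) auto
  then show ?thesis
    by (simp add: free_act_def lookup_pm_scale scale_sum_right)
qed

lemma free_act_diff: "free_act scale ga m (p - q) = free_act scale ga m p - free_act scale ga m q"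
  using free_act_add[of ga m "p - q" q] by simp

lemma free_act_sum: "free_act scale ga m (\<Sum>i\<in>I. p i) = (\<Sum>i\<in>I. free_act scale ga m (p i))"
  by (induction I rule: infinite_finite_induct) (simp_all add: free_act_zero free_act_add)

lemma free_act_gen: "free_act scale ga m (free_gen x) = ga m x"
  by (simp add: free_gen_def free_act_single)

lemma free_act_gen_gen: "free_act scale ga m (free_gen x * free_gen y) = ga (ga m x) y"
  by (simp add: free_gen_def mult_single free_act_single plus_fword_def)

end

lemma free_elems_diff: "\<lbrakk>p \<in> free_elems S; q \<in> free_elems S\<rbrakk> \<Longrightarrow> p - q \<in> free_elems S"
  using Poly_Mapping.keys_diff[of p q] by (auto simp: free_elems_def)

lemma free_elems_sum: "(\<And>i. i \<in> I \<Longrightarrow> p i \<in> free_elems S) \<Longrightarrow> (\<Sum>i\<in>I. p i) \<in> free_elems S"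
  by (induction I rule: infinite_finite_induct) (simp_all add: free_elems_zero free_elems_add)

locale generator_action = vector_space sc
  for sc :: "'k::field \<Rightarrow> 'm::ab_group_add \<Rightarrow> 'm" +
  fixes S :: "'g set" and M :: "'m set" and ga :: "'m \<Rightarrow> 'g \<Rightarrow> 'm"
  assumes subspace_M: "subspace M"
    and gen_closed: "\<lbrakk>m \<in> M; x \<in> S\<rbrakk> \<Longrightarrow> ga m x \<in> M"
    and gen_add: "\<lbrakk>m \<in> M; n \<in> M; x \<in> S\<rbrakk> \<Longrightarrow> ga (m + n) x = ga m x + ga n x"
    and gen_scale: "\<lbrakk>m \<in> M; x \<in> S\<rbrakk> \<Longrightarrow> ga (sc k m) x = sc k (ga m x)"
begin

lemma word_closed: "\<lbrakk>m \<in> M; set xs \<subseteq> S\<rbrakk> \<Longrightarrow> foldl ga m xs \<in> M"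
  by (induction xs arbitrary: m) (simp_all add: gen_closed)

lemma word_add:
  "\<lbrakk>m \<in> M; n \<in> M; set xs \<subseteq> S\<rbrakk> \<Longrightarrow> foldl ga (m + n) xs = foldl ga m xs + foldl ga n xs"
  by (induction xs arbitrary: m n) (simp_all add: gen_closed gen_add)

lemma word_scale: "\<lbrakk>m \<in> M; set xs \<subseteq> S\<rbrakk> \<Longrightarrow> foldl ga (sc k m) xs = sc k (foldl ga m xs)"
  by (induction xs arbitrary: m) (simp_all add: gen_closed gen_scale)

lemma word_lincomb:
  assumes "\<And>i. i \<in> I \<Longrightarrow> f i \<in> M" "set xs \<subseteq> S"
  shows "foldl ga (\<Sum>i\<in>I. sc (c i) (f i)) xs = (\<Sum>i\<in>I. sc (c i) (foldl ga (f i) xs))"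
proof -
  have zero: "foldl ga 0 xs = 0"
    using word_scale[of 0 xs 0] assms(2) subspace_0[OF subspace_M] by simp
  from assms(1) show ?thesis
  proof (induction I rule: infinite_finite_induct)
    case (insert i I)
    have "(\<Sum>i\<in>I. sc (c i) (f i)) \<in> M" "sc (c i) (f i) \<in> M"
      using insert.prems by (auto intro!: subspace_sum subspace_scale simp: subspace_M)
    then show ?case
      using insert assms(2) by (simp add: word_add word_scale)
  qed (simp_all add: zero)
qed

lemma word_in_free_elems: "\<lbrakk>p \<in> free_elems S; u \<in> Poly_Mapping.keys p\<rbrakk> \<Longrightarrow> set (letters u) \<subseteq> S"
  by (simp add: free_elems_def)

lemma free_act_closed: "\<lbrakk>m \<in> M; p \<in> free_elems S\<rbrakk> \<Longrightarrow> free_act sc ga m p \<in> M"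
  unfolding free_act_def
  by (intro subspace_sum subspace_scale subspace_M word_closed word_in_free_elems)

lemma free_act_add_left:
  "\<lbrakk>m \<in> M; n \<in> M; p \<in> free_elems S\<rbrakk> \<Longrightarrow> free_act sc ga (m + n) p = free_act sc ga m p + free_act sc ga n p"
  by (simp add: free_act_def word_add word_in_free_elems scale_right_distrib flip: sum.distrib)

lemma free_act_scale_left:
  "\<lbrakk>m \<in> M; p \<in> free_elems S\<rbrakk> \<Longrightarrow> free_act sc ga (sc k m) p = sc k (free_act sc ga m p)"
  by (simp add: free_act_def word_scale word_in_free_elems scale_sum_right mult.commute)

text \<open>Words act by composition, and concatenation of words is composition; the rest is bilinear
  expansion of both factors into words.\<close>

lemma free_act_mult:
  assumes m: "m \<in> M" and p: "p \<in> free_elems S" and q: "q \<in> free_elems S"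
  shows "free_act sc ga m (p * q) = free_act sc ga (free_act sc ga m p) q"
proof -
  let ?p = "Poly_Mapping.lookup p" and ?q = "Poly_Mapping.lookup q"
  let ?w = "\<lambda>u v. foldl ga (foldl ga m (letters u)) (letters v)"
  have "p * q = (\<Sum>u\<in>Poly_Mapping.keys p. Poly_Mapping.single u (?p u))
      * (\<Sum>v\<in>Poly_Mapping.keys q. Poly_Mapping.single v (?q v))"
    by (simp only: sum_monomials)
  then have "free_act sc ga m (p * q)
      = (\<Sum>u\<in>Poly_Mapping.keys p. \<Sum>v\<in>Poly_Mapping.keys q. sc (?p u * ?q v) (?w u v))"
    by (simp add: sum_product mult_single free_act_sum free_act_single plus_fword_def)
  also have "\<dots> = (\<Sum>v\<in>Poly_Mapping.keys q. \<Sum>u\<in>Poly_Mapping.keys p. sc (?p u * ?q v) (?w u v))"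
    by (rule sum.swap)
  also have "\<dots> = (\<Sum>v\<in>Poly_Mapping.keys q. sc (?q v) (\<Sum>u\<in>Poly_Mapping.keys p. sc (?p u) (?w u v)))"
    by (simp add: scale_sum_right mult.commute)
  also have "\<dots> = (\<Sum>v\<in>Poly_Mapping.keys q. sc (?q v) (foldl ga (free_act sc ga m p) (letters v)))"
    unfolding free_act_def using m p q
    by (intro sum.cong refl arg_cong[of _ _ "sc _"])
       (simp add: word_lincomb word_closed word_in_free_elems)
  finally show ?thesis
    by (simp add: free_act_def)
qed

end

locale relation_action = generator_action sc S M ga
  for sc :: "'k::field \<Rightarrow> 'm::ab_group_add \<Rightarrow> 'm" and S :: "'g set" and M ga +
  fixes Rl :: "('g fword \<Rightarrow>\<^sub>0 'k) set"
  assumes rels_free: "Rl \<subseteq> free_elems S"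
    and rels_act: "\<lbrakk>p \<in> Rl; m \<in> M\<rbrakk> \<Longrightarrow> free_act sc ga m p = 0"
begin

text \<open>The elements annihilating \<open>M\<close> form a two-sided ideal: for \<open>a * p\<close> because \<open>a\<close> maps \<open>M\<close> into
  itself, for \<open>p * a\<close> because \<open>a\<close> acts linearly.\<close>

lemma rel_ideal_annihilates:
  "p \<in> rel_ideal S Rl \<Longrightarrow> p \<in> free_elems S \<and> (\<forall>m\<in>M. free_act sc ga m p = 0)"
proof (induction rule: rel_ideal.induct)
  case (mult_right p a)
  have "free_act sc ga 0 a = 0"
    using free_act_scale_left[of 0 a 0] mult_right(2) subspace_0[OF subspace_M] by simp
  with mult_right show ?case
    by (simp add: free_elems_mult free_act_mult)
qed (use rels_free rels_act in \<open>auto simp: free_elems_zero free_act_zero free_elems_add free_act_add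
  free_elems_scale free_act_pm_scale free_elems_mult free_act_mult free_act_closed\<close>)

lemma quot_act_class:
  assumes m: "m \<in> M" and a: "a \<in> free_elems S"
  shows "quot_act sc ga m (rel_class S Rl a) = free_act sc ga m a"
proof -
  have "free_act sc ga m b = free_act sc ga m a" if "b \<in> rel_class S Rl a" for b
  proof -
    have "b - a \<in> rel_ideal S Rl"
      using that by (simp add: rel_class_def)
    from rel_ideal_annihilates[OF this] have "free_act sc ga m (b - a) = 0"
      using m by blast
    then show ?thesis
      by (simp only: free_act_diff right_minus_eq)
  qed
  then have "free_act sc ga m ` rel_class S Rl a = {free_act sc ga m a}"
    using rel_class_self[OF a, of Rl] by blast
  then show ?thesis
    by (simp add: quot_act_def)
qed

lemma quot_act_gen:
  "\<lbrakk>m \<in> M; x \<in> S\<rbrakk> \<Longrightarrow> quot_act sc ga m (rel_class S Rl (free_gen x)) = ga m x"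
  by (simp add: quot_act_class free_gen_in free_act_gen)

lemma right_module_presented: "right_module (presented_algebra S Rl) sc M (quot_act sc ga)"
proof (intro right_module.intro nonunital_algebra_presented vector_space_axioms
    right_module_axioms.intro subspace_M)
qed (elim elems_presentedE, simp add: presented_add presented_scale presented_mult quot_act_class
      free_elems_add free_elems_scale free_elems_mult free_act_closed free_act_add free_act_add_left
      free_act_scale_left free_act_pm_scale free_act_mult subspace_add subspace_scale subspace_M)+

end


section \<open>Transport of an action along a linear map\<close>

text \<open>Compatibility with \<open>h\<close> forces \<open>ga'\<close> to be linear on the image of \<open>h\<close>, so linearity is proved on
  one side only.\<close>

locale generator_action_map = generator_action sc S M ga + target: vector_space sc'
  for sc :: "'k::field \<Rightarrow> 'm::ab_group_add \<Rightarrow> 'm" and S :: "'g set" and M ga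
    and sc' :: "'k \<Rightarrow> 'n::ab_group_add \<Rightarrow> 'n" +
  fixes h :: "'m \<Rightarrow> 'n" and ga' :: "'n \<Rightarrow> 'g \<Rightarrow> 'n"
  assumes map_add: "\<lbrakk>m \<in> M; n \<in> M\<rbrakk> \<Longrightarrow> h (m + n) = h m + h n"
    and map_scale: "m \<in> M \<Longrightarrow> h (sc k m) = sc' k (h m)"
    and map_gen: "\<lbrakk>m \<in> M; x \<in> S\<rbrakk> \<Longrightarrow> h (ga m x) = ga' (h m) x"
begin

lemma map_zero: "h 0 = 0"
  using map_scale[of 0 0] subspace_0[OF subspace_M] by simp

lemma generator_action_image: "generator_action sc' S (h ` M) ga'"
proof unfold_locales
  show "target.subspace (h ` M)"
    unfolding target.subspace_def
  proof (intro conjI ballI allI)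
    show "0 \<in> h ` M"
      using map_zero subspace_0[OF subspace_M] by (metis imageI)
  qed (auto simp: subspace_M subspace_add subspace_scale simp flip: map_add map_scale)
qed (auto simp: gen_closed gen_add gen_scale subspace_add subspace_scale subspace_M
       simp flip: map_gen map_add map_scale)

lemma map_word: "\<lbrakk>m \<in> M; set xs \<subseteq> S\<rbrakk> \<Longrightarrow> h (foldl ga m xs) = foldl ga' (h m) xs"
  by (induction xs arbitrary: m) (simp_all add: gen_closed map_gen)

lemma map_lincomb:
  "(\<And>i. i \<in> I \<Longrightarrow> f i \<in> M) \<Longrightarrow> h (\<Sum>i\<in>I. sc (c i) (f i)) = (\<Sum>i\<in>I. sc' (c i) (h (f i)))"
proof (induction I rule: infinite_finite_induct)
  case (insert i I)
  have "(\<Sum>i\<in>I. sc (c i) (f i)) \<in> M" "sc (c i) (f i) \<in> M"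
    using insert.prems by (auto intro!: subspace_sum subspace_scale simp: subspace_M)
  then show ?case
    using insert by (simp add: map_add map_scale)
qed (simp_all add: map_zero)

lemma map_free_act:
  "\<lbrakk>m \<in> M; p \<in> free_elems S\<rbrakk> \<Longrightarrow> h (free_act sc ga m p) = free_act sc' ga' (h m) p"
  by (simp add: free_act_def map_lincomb map_word word_closed word_in_free_elems)

lemma relation_action_image:
  assumes "relation_action sc S M ga Rl"
  shows "relation_action sc' S (h ` M) ga' Rl"
proof -
  interpret relation_action sc S M ga Rl by fact
  interpret image: generator_action sc' S "h ` M" ga' by (rule generator_action_image)
  show ?thesis
    by unfold_locales (use rels_free in \<open>auto simp: rels_act map_zero subset_iff simp flip: map_free_act\<close>)
qed

lemma right_module_iso_image:
  assumes "relation_action sc S M ga Rl" and inj: "inj_on h M"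
  shows "right_module_iso (presented_algebra S Rl) sc M (quot_act sc ga) sc' (h ` M) (quot_act sc' ga') h"
proof -
  interpret relation_action sc S M ga Rl by fact
  interpret image: relation_action sc' S "h ` M" ga' Rl
    by (rule relation_action_image) fact
  show ?thesis
    unfolding right_module_iso_def
  proof (intro conjI ballI allI)
    show "bij_betw h M (h ` M)"
      using inj by (rule inj_on_imp_bij_betw)
    show "h (quot_act sc ga m X) = quot_act sc' ga' (h m) X"
      if "m \<in> M" "X \<in> elems (presented_algebra S Rl)" for m X
      using that by (elim elems_presentedE) (simp add: quot_act_class image.quot_act_class map_free_act)
  qed (simp_all add: map_add map_scale)
qed

end


section \<open>Finitely supported functions\<close>

interpretation function_space: vector_space "fun_scale :: 'k::field \<Rightarrow> ('x \<Rightarrow> 'k) \<Rightarrow> _"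
  by unfold_locales (simp_all add: fun_scale_def fun_eq_iff algebra_simps)

interpretation poly_mapping_space: vector_space "pm_scale :: 'k::field \<Rightarrow> ('x \<Rightarrow>\<^sub>0 'k) \<Rightarrow> _"
  by unfold_locales (simp_all add: pm_scale_add pm_scale_add_left pm_scale_scale pm_scale_one)

lemma fin_supp_functions_iff:
  "\<theta> \<in> fin_supp_functions X \<longleftrightarrow> {x. \<theta> x \<noteq> 0} \<subseteq> X \<and> finite {x. \<theta> x \<noteq> 0}"
proof -
  have "{x \<in> X. \<theta> x \<noteq> 0} = {x. \<theta> x \<noteq> 0}" if "\<forall>x. x \<notin> X \<longrightarrow> \<theta> x = 0"
    using that by auto
  then show ?thesis
    by (auto simp: fin_supp_functions_def)
qed

lemma lookup_Abs_fin_supp: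
  "\<theta> \<in> fin_supp_functions X \<Longrightarrow> Poly_Mapping.lookup (Abs_poly_mapping \<theta>) = \<theta>"
  by (simp add: fin_supp_functions_iff Abs_poly_mapping_inverse)

lemma Abs_poly_mapping_image:
  "Abs_poly_mapping ` fin_supp_functions (verts F) = (VF_space F :: ('x \<Rightarrow>\<^sub>0 'k::field) set)"
proof (intro equalityI subsetI)
  fix p :: "'x \<Rightarrow>\<^sub>0 'k" assume "p \<in> Abs_poly_mapping ` fin_supp_functions (verts F)"
  then show "p \<in> VF_space F"
    by (auto simp: VF_space_def lookup_Abs_fin_supp in_keys_iff) (auto simp: fin_supp_functions_iff)
next
  fix p :: "'x \<Rightarrow>\<^sub>0 'k" assume "p \<in> VF_space F"
  then have "Poly_Mapping.lookup p \<in> fin_supp_functions (verts F)"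
    by (auto simp: fin_supp_functions_iff VF_space_def keys.rep_eq)
  moreover have "p = Abs_poly_mapping (Poly_Mapping.lookup p)"
    by (simp add: lookup_inverse)
  ultimately show "p \<in> Abs_poly_mapping ` fin_supp_functions (verts F)"
    by blast
qed

lemma inj_on_Abs_poly_mapping: "inj_on Abs_poly_mapping (fin_supp_functions X)"
  by (metis inj_onI lookup_Abs_fin_supp)

lemma lookup_sum_keys_if:
  fixes p :: "'x \<Rightarrow>\<^sub>0 'k::field"
  assumes "\<And>v. P v \<longleftrightarrow> v = z"
  shows "(\<Sum>v\<in>Poly_Mapping.keys p. Poly_Mapping.lookup p v * (if P v then 1 else 0)) = Poly_Mapping.lookup p z"
  using assms by (simp add: in_keys_iff if_distrib cong: if_cong)


section \<open>The module of a branching system\<close>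

lemma sum_fun_app: "(\<Sum>i\<in>I. f i) x = (\<Sum>i\<in>I. f i x :: 'k::comm_monoid_add)"
  by (induction I rule: infinite_finite_induct) simp_all

lemma sum_partition_family:
  assumes "partition_family P I Y" "finite I"
  shows "(\<Sum>i\<in>I. if x \<in> P i then c else 0) = (if x \<in> Y then c else (0::'k::comm_monoid_add))"
proof (cases "x \<in> Y")
  case True
  then obtain j where j: "j \<in> I" "x \<in> P j"
    using assms(1) by (auto simp: partition_family_def)
  then have "x \<in> P i \<longleftrightarrow> i = j" if "i \<in> I" for i
    using assms(1) that by (auto simp: partition_family_def disjoint_family_on_def)
  then have "(\<Sum>i\<in>I. if x \<in> P i then c else 0) = (\<Sum>i\<in>I. if i = j then c else 0)"
    by (intro sum.cong) auto
  with True j assms(2) show ?thesis by simp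
next
  case False
  then show ?thesis
    using assms(1) by (auto simp: partition_family_def intro!: sum.neutral)
qed

context weighted_graph
begin

lemma finite_out_arcs: "v \<in> verts E \<Longrightarrow> finite (out_arcs E v)"
  using row_finite by (simp add: row_finite_def)

text \<open>Row-finiteness enters here: the maximum of an infinite set of weights would be meaningless.\<close>

lemma weight_le_vertex_weight: "e \<in> arcs E \<Longrightarrow> w e \<le> vertex_weight E w (tail E e)"
  using finite_out_arcs[of "tail E e"] by (auto simp: vertex_weight_def)

lemma edge_elt_free: "\<lbrakk>e \<in> arcs E; 1 \<le> i\<rbrakk> \<Longrightarrow> edge_elt w e i \<in> free_elems (lpa_gens E w)"
  by (auto simp: edge_elt_def free_elems_zero lpa_gens_def intro!: free_gen_in)

lemma ghost_elt_free: "\<lbrakk>e \<in> arcs E; 1 \<le> i\<rbrakk> \<Longrightarrow> ghost_elt w e i \<in> free_elems (lpa_gens E w)"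
  by (auto simp: ghost_elt_def free_elems_zero lpa_gens_def intro!: free_gen_in)

lemma vertex_elt_free: "v \<in> verts E \<Longrightarrow> vertex_elt v \<in> free_elems (lpa_gens E w)"
  by (auto simp: lpa_gens_def intro!: free_gen_in)

lemma lpa_rels_free: "lpa_rels E w \<subseteq> free_elems (lpa_gens E w)"
proof
  note free = free_elems_diff free_elems_mult edge_elt_free ghost_elt_free vertex_elt_free
  fix p :: "('v,'e) lpa_gen fword \<Rightarrow>\<^sub>0 'k::field"
  assume "p \<in> lpa_rels E w"
  then show "p \<in> free_elems (lpa_gens E w)"
  proof cases
    case (vertices u v)
    then show ?thesis
      by (simp add: free free_elems_zero)
  next
    case (edge_source e i)
    then show ?thesis
      by (simp add: free)
  next
    case (edge_range e i)
    then show ?thesis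
      by (simp add: free)
  next
    case (ghost_range e i)
    then show ?thesis
      by (simp add: free)
  next
    case (ghost_source e i)
    then show ?thesis
      by (simp add: free)
  next
    case (ghost_edge v e f)
    show ?thesis
      unfolding ghost_edge(1) using ghost_edge(2-4)
      by (intro free_elems_diff free_elems_sum free_elems_mult edge_elt_free ghost_elt_free)
         (auto simp: free_elems_zero vertex_elt_free)
  next
    case (edge_ghost v i j)
    show ?thesis
      unfolding edge_ghost(1) using edge_ghost(2-4)
      by (intro free_elems_diff free_elems_sum free_elems_mult edge_elt_free ghost_elt_free)
         (auto simp: free_elems_zero vertex_elt_free)
  qed
qed

end

locale weighted_branching_system = weighted_graph E w
  for E :: "('v,'e) pre_digraph" and w +
  fixes X :: "'x set" and R :: "'e \<times> nat \<Rightarrow> 'x set" and D :: "'v \<Rightarrow> 'x set"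
    and g :: "'e \<times> nat \<Rightarrow> 'x \<Rightarrow> 'x"
  assumes branching: "branching_system E w X R D g"
begin

abbreviation act :: "('x \<Rightarrow> 'k::field) \<Rightarrow> ('v,'e) lpa_gen \<Rightarrow> 'x \<Rightarrow> 'k" where
  "act \<equiv> branching_gen_act R D g"

lemma D_subset: "v \<in> verts E \<Longrightarrow> D v \<subseteq> X"
  using branching by (simp add: branching_system_def)

lemma D_disjoint: "\<lbrakk>u \<in> verts E; v \<in> verts E; u \<noteq> v; x \<in> D u\<rbrakk> \<Longrightarrow> x \<notin> D v"
proof -
  assume *: "u \<in> verts E" "v \<in> verts E" "u \<noteq> v" "x \<in> D u"
  have "partition_family D (verts E) X"
    using branching by (simp add: branching_system_def)
  with * show "x \<notin> D v"
    by (simp add: partition_family_def disjoint_family_on_def) blast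
qed

lemma g_inj: "\<lbrakk>e \<in> arcs E; i \<in> {1..w e}\<rbrakk> \<Longrightarrow> inj_on (g (e,i)) (R (e,i))"
  using branching by (simp add: branching_system_def hat_graph_def)

lemma R_partition: "\<lbrakk>v \<in> verts E; i \<in> {1..vertex_weight E w v}\<rbrakk> \<Longrightarrow>
    partition_family (\<lambda>e. R (e,i)) {e \<in> out_arcs E v. i \<le> w e} (D v)"
  using branching by (simp add: branching_system_def)

lemma gR_partition: "e \<in> arcs E \<Longrightarrow>
    partition_family (\<lambda>i. g (e,i) ` R (e,i)) {1..w e} (D (head E e))"
  using branching by (simp add: branching_system_def)

lemma R_subset: "\<lbrakk>e \<in> arcs E; i \<in> {1..w e}\<rbrakk> \<Longrightarrow> R (e,i) \<subseteq> D (tail E e)"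
  using R_partition[of "tail E e" i] weight_le_vertex_weight[of e]
  by (fastforce simp: partition_family_def)

lemma gR_subset: "\<lbrakk>e \<in> arcs E; i \<in> {1..w e}\<rbrakk> \<Longrightarrow> g (e,i) ` R (e,i) \<subseteq> D (head E e)"
  using gR_partition[of e] unfolding partition_family_def by blast

lemma R_disjoint:
  assumes "e \<in> arcs E" "f \<in> arcs E" "tail E e = tail E f" "e \<noteq> f" "i \<in> {1..w e}" "i \<in> {1..w f}"
  shows "R (e,i) \<inter> R (f,i) = {}"
proof -
  have "i \<in> {1..vertex_weight E w (tail E e)}"
    using weight_le_vertex_weight[of e] assms by auto
  from R_partition[OF _ this] show ?thesis
    using assms by (auto simp: partition_family_def disjoint_family_on_def)
qed

lemma gR_disjoint:
  "\<lbrakk>e \<in> arcs E; i \<in> {1..w e}; j \<in> {1..w e}; i \<noteq> j\<rbrakk> \<Longrightarrow> g (e,i) ` R (e,i) \<inter> g (e,j) ` R (e,j) = {}"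
  using gR_partition[of e] unfolding partition_family_def disjoint_family_on_def by blast

text \<open>The edges \<open>e\<close> and \<open>f\<close> share their source, so for \<open>e \<noteq> f\<close> the function \<open>\<theta>.e\<^sub>i\<^sup>*\<close>, supported on
  \<open>R (e, i)\<close>, vanishes on the disjoint set \<open>R (f, i)\<close>, which is all that \<open>f\<^sub>i\<close> sees.\<close>

lemma act_ghost_edge:
  assumes "e \<in> arcs E" "f \<in> arcs E" "tail E e = tail E f" "i \<in> {1..w e}" "i \<in> {1..w f}"
  shows "act (act \<theta> (Ghost e i)) (Edge f i) =
    (\<lambda>x. if x \<in> g (e,i) ` R (e,i) then if e = f then \<theta> x else 0 else 0)"
proof
  fix x
  have "inv_into (R (f,i)) (g (f,i)) x \<in> R (e,i) \<longleftrightarrow> e = f" if "x \<in> g (f,i) ` R (f,i)"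
    using R_disjoint[OF assms(1-3) _ assms(4,5)] inv_into_into[OF that] by auto
  then show "act (act \<theta> (Ghost e i)) (Edge f i) x =
    (if x \<in> g (e,i) ` R (e,i) then if e = f then \<theta> x else 0 else 0)"
    by (auto simp: f_inv_into_f)
qed

text \<open>Dually, for \<open>i \<noteq> j\<close> the function \<open>\<theta>.e\<^sub>i\<close> is supported on the image of \<open>g (e, i)\<close>, which is
  disjoint from the image of \<open>g (e, j)\<close>, where \<open>e\<^sub>j\<^sup>*\<close> evaluates.\<close>

lemma act_edge_ghost:
  assumes "e \<in> arcs E" "i \<in> {1..w e}" "j \<in> {1..w e}"
  shows "act (act \<theta> (Edge e i)) (Ghost e j) =
    (\<lambda>x. if x \<in> R (e,i) then if i = j then \<theta> x else 0 else 0)"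
proof
  fix x
  have "g (e,j) x \<in> g (e,i) ` R (e,i) \<longleftrightarrow> i = j" if "x \<in> R (e,j)"
    using gR_disjoint[OF assms] that by auto
  then show "act (act \<theta> (Edge e i)) (Ghost e j) x =
    (if x \<in> R (e,i) then if i = j then \<theta> x else 0 else 0)"
    using assms by (auto simp: inv_into_f_f[OF g_inj])
qed

text \<open>In the sums of the last two kinds of relations, with \<open>e = f\<close> or \<open>i = j\<close>, each term acts as the
  restriction to one member of a partition, so the sum acts as the restriction to the partitioned set;
  otherwise every term acts as zero.\<close>

lemma lpa_rels_act:
  assumes "p \<in> lpa_rels E w"
  shows "free_act fun_scale act \<theta> p = 0"
  using assms
proof cases
  case (vertices u v)
  then show ?thesis
    using D_disjoint[of u v]
    by (auto simp: function_space.free_act_diff function_space.free_act_gen function_space.free_act_gen_gen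
        function_space.free_act_zero fun_eq_iff)
next
  case (edge_source e i)
  then show ?thesis
    using R_subset[of e i] inv_into_into[of _ "g (e,i)" "R (e,i)"]
    by (auto simp: function_space.free_act_diff function_space.free_act_gen function_space.free_act_gen_gen
        edge_elt_def fun_eq_iff)
next
  case (edge_range e i)
  then show ?thesis
    using gR_subset[of e i]
    by (auto simp: function_space.free_act_diff function_space.free_act_gen function_space.free_act_gen_gen
        edge_elt_def fun_eq_iff)
next
  case (ghost_range e i)
  then show ?thesis
    using gR_subset[of e i]
    by (auto simp: function_space.free_act_diff function_space.free_act_gen function_space.free_act_gen_gen
        ghost_elt_def fun_eq_iff)
next
  case (ghost_source e i)
  then show ?thesis
    using R_subset[of e i]
    by (auto simp: function_space.free_act_diff function_space.free_act_gen function_space.free_act_gen_gen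
        ghost_elt_def fun_eq_iff)
next
  case (ghost_edge v e f)
  let ?n = "vertex_weight E w v" and ?c = "\<lambda>x. if e = f then \<theta> x else 0"
  have "(\<Sum>i = 1..?n. free_act fun_scale act \<theta> (ghost_elt w e i * edge_elt w f i)) x
      = (if x \<in> D (head E e) then ?c x else 0)" for x
  proof -
    have "free_act fun_scale act \<theta> (ghost_elt w e i * edge_elt w f i) x
        = (if i \<le> w e then if x \<in> g (e,i) ` R (e,i) then ?c x else 0 else 0)" if "i \<in> {1..?n}" for i
    proof (cases "i \<le> w e \<and> i \<le> w f")
      case True
      then show ?thesis
        using act_ghost_edge[of e f i \<theta>] ghost_edge that
        by (simp add: ghost_elt_def edge_elt_def function_space.free_act_gen_gen del: branching_gen_act.simps)
    qed (auto simp: ghost_elt_def edge_elt_def function_space.free_act_zero)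
    then have "(\<Sum>i = 1..?n. free_act fun_scale act \<theta> (ghost_elt w e i * edge_elt w f i)) x
        = (\<Sum>i = 1..?n. if i \<le> w e then if x \<in> g (e,i) ` R (e,i) then ?c x else 0 else 0)"
      unfolding sum_fun_app by (rule sum.cong[OF refl])
    also have "\<dots> = (\<Sum>i\<in>{i\<in>{1..?n}. i \<le> w e}. if x \<in> g (e,i) ` R (e,i) then ?c x else 0)"
      by (rule sum.inter_filter[symmetric]) simp
    also have "{i\<in>{1..?n}. i \<le> w e} = {1..w e}"
      using ghost_edge weight_le_vertex_weight[of e] by auto
    also have "(\<Sum>i\<in>{1..w e}. if x \<in> g (e,i) ` R (e,i) then ?c x else 0)
        = (if x \<in> D (head E e) then ?c x else 0)"
      using ghost_edge by (intro sum_partition_family gR_partition) auto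
    finally show ?thesis .
  qed
  then show ?thesis
    using ghost_edge(1)
    by (auto simp: function_space.free_act_diff function_space.free_act_sum function_space.free_act_gen
        function_space.free_act_zero fun_eq_iff)
next
  case (edge_ghost v i j)
  let ?c = "\<lambda>x. if i = j then \<theta> x else 0"
  have "(\<Sum>e\<in>out_arcs E v. free_act fun_scale act \<theta> (edge_elt w e i * ghost_elt w e j)) x
      = (if x \<in> D v then ?c x else 0)" for x
  proof -
    have "free_act fun_scale act \<theta> (edge_elt w e i * ghost_elt w e j) x
        = (if i \<le> w e then if x \<in> R (e,i) then ?c x else 0 else 0)" if "e \<in> out_arcs E v" for e
    proof (cases "i \<le> w e \<and> j \<le> w e")
      case True
      then show ?thesis
        using act_edge_ghost[of e i j \<theta>] edge_ghost that
        by (simp add: ghost_elt_def edge_elt_def function_space.free_act_gen_gen del: branching_gen_act.simps)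
    qed (auto simp: ghost_elt_def edge_elt_def function_space.free_act_zero)
    then have "(\<Sum>e\<in>out_arcs E v. free_act fun_scale act \<theta> (edge_elt w e i * ghost_elt w e j)) x
        = (\<Sum>e\<in>out_arcs E v. if i \<le> w e then if x \<in> R (e,i) then ?c x else 0 else 0)"
      unfolding sum_fun_app by (rule sum.cong[OF refl])
    also have "\<dots> = (\<Sum>e\<in>{e\<in>out_arcs E v. i \<le> w e}. if x \<in> R (e,i) then ?c x else 0)"
      using edge_ghost finite_out_arcs[of v] by (simp only: sum.inter_filter)
    also have "\<dots> = (if x \<in> D v then ?c x else 0)"
      by (rule sum_partition_family[OF R_partition[OF edge_ghost(2,3)]])
         (use finite_out_arcs[OF edge_ghost(2)] in \<open>rule rev_finite_subset; blast\<close>)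
    finally show ?thesis .
  qed
  then show ?thesis
    using edge_ghost(1)
    by (auto simp: function_space.free_act_diff function_space.free_act_sum function_space.free_act_gen
        function_space.free_act_zero fun_eq_iff)
qed

text \<open>Finiteness of supports is preserved because the support of \<open>\<theta>.e\<^sub>i\<close> is the image under \<open>g\<close>, and
  that of \<open>\<theta>.e\<^sub>i\<^sup>*\<close> the preimage under the injection \<open>g\<close>, of a part of the support of \<open>\<theta>\<close>.\<close>

lemma act_closed:
  assumes \<theta>: "\<theta> \<in> fin_supp_functions X" and x: "x \<in> lpa_gens E w"
  shows "act \<theta> x \<in> fin_supp_functions X"
proof -
  have fin: "finite {x. \<theta> x \<noteq> 0}" and sub: "{x. \<theta> x \<noteq> 0} \<subseteq> X"
    using \<theta> by (auto simp: fin_supp_functions_iff)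
  from x consider (v) v where "x = Vertex v" "v \<in> verts E"
    | (e) e i where "x = Edge e i" "e \<in> arcs E" "i \<in> {1..w e}"
    | (g) e i where "x = Ghost e i" "e \<in> arcs E" "i \<in> {1..w e}"
    by (auto simp: lpa_gens_def)
  then show ?thesis
  proof cases
    case v
    have "{y. act \<theta> x y \<noteq> 0} \<subseteq> {x. \<theta> x \<noteq> 0}"
      using v by auto
    then show ?thesis
      using fin sub finite_subset unfolding fin_supp_functions_iff by blast
  next
    case e
    have "{y. act \<theta> x y \<noteq> 0} \<subseteq> g (e,i) ` {x. \<theta> x \<noteq> 0}"
      using e by (auto simp: f_inv_into_f intro!: image_eqI[of _ _ "inv_into _ _ _"] split: if_splits)
    moreover have "{y. act \<theta> x y \<noteq> 0} \<subseteq> X"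
      using e gR_subset[of e i] D_subset[of "head E e"] by (auto split: if_splits)
    ultimately show ?thesis
      using finite_subset finite_imageI[OF fin] unfolding fin_supp_functions_iff by blast
  next
    case g
    have "{y. act \<theta> x y \<noteq> 0} \<subseteq> g (e,i) -` {x. \<theta> x \<noteq> 0} \<inter> R (e,i)"
      using g by (auto split: if_splits)
    moreover have "{y. act \<theta> x y \<noteq> 0} \<subseteq> X"
      using g R_subset[of e i] D_subset[of "tail E e"] by (auto split: if_splits)
    ultimately show ?thesis
      using finite_subset finite_vimage_IntI[OF fin g_inj] g unfolding fin_supp_functions_iff by blast
  qed
qed

lemma subspace_fin_supp_functions:
  "function_space.subspace (fin_supp_functions X :: ('x \<Rightarrow> 'k::field) set)"
  unfolding function_space.subspace_def
proof (intro conjI ballI allI)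
  fix \<theta> \<eta> :: "'x \<Rightarrow> 'k" assume *: "\<theta> \<in> fin_supp_functions X" "\<eta> \<in> fin_supp_functions X"
  have "{x. (\<theta> + \<eta>) x \<noteq> 0} \<subseteq> {x. \<theta> x \<noteq> 0} \<union> {x. \<eta> x \<noteq> 0}"
    by auto
  with * show "\<theta> + \<eta> \<in> fin_supp_functions X"
    unfolding fin_supp_functions_iff by (meson Un_least finite_UnI finite_subset subset_trans)
next
  fix \<theta> :: "'x \<Rightarrow> 'k" and k assume *: "\<theta> \<in> fin_supp_functions X"
  have "{x. fun_scale k \<theta> x \<noteq> 0} \<subseteq> {x. \<theta> x \<noteq> 0}"
    by (auto simp: fun_scale_def)
  with * show "fun_scale k \<theta> \<in> fin_supp_functions X"
    unfolding fin_supp_functions_iff by (meson finite_subset subset_trans)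
qed (simp add: fin_supp_functions_iff)

lemma relation_action_branching:
  "relation_action (fun_scale :: 'k::field \<Rightarrow> ('x \<Rightarrow> 'k) \<Rightarrow> _) (lpa_gens E w) (fin_supp_functions X) act (lpa_rels E w)"
proof unfold_locales
  show "act (\<theta> + \<eta>) x = act \<theta> x + act \<eta> x" for \<theta> \<eta> :: "'x \<Rightarrow> 'k" and x
    by (cases x) (auto simp: fun_eq_iff)
  show "act (fun_scale k \<theta>) x = fun_scale k (act \<theta> x)" for k :: 'k and \<theta> and x :: "('v,'e) lpa_gen"
    by (cases x) (auto simp: fun_eq_iff fun_scale_def)
qed (rule subspace_fin_supp_functions act_closed lpa_rels_free lpa_rels_act; assumption?)+

end


section \<open>Representation graphs\<close>

locale weighted_representation_graph = weighted_graph E w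
  for E :: "('v,'e) pre_digraph" and w +
  fixes F :: "('x,'f) pre_digraph" and \<phi>0 :: "'x \<Rightarrow> 'v" and \<phi>1 :: "'f \<Rightarrow> 'e \<times> nat"
  assumes representation: "representation_graph E w F \<phi>0 \<phi>1"
begin

abbreviation "D \<equiv> rep_D F \<phi>0"
abbreviation "R \<equiv> rep_R E F \<phi>0 \<phi>1"
abbreviation "De \<equiv> rep_De E F \<phi>0 \<phi>1"
abbreviation "g \<equiv> rep_g F \<phi>1"

sublocale F: wf_digraph F
  using representation by (simp add: representation_graph_def)

lemma vertex_map: "u \<in> verts F \<Longrightarrow> \<phi>0 u \<in> verts E"
  using representation by (simp add: representation_graph_def graph_hom_def hat_graph_def)

lemma arc_map:
  assumes "f \<in> arcs F"
  shows "st (\<phi>1 f) \<in> arcs E" "1 \<le> tag (\<phi>1 f)" "tag (\<phi>1 f) \<le> w (st (\<phi>1 f))"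
    and "tail E (st (\<phi>1 f)) = \<phi>0 (tail F f)" "head E (st (\<phi>1 f)) = \<phi>0 (head F f)"
  using representation assms
  by (fastforce simp: representation_graph_def graph_hom_def hat_graph_def)+

lemma out_arc_exists:
  "\<lbrakk>u \<in> verts F; i \<in> {1..vertex_weight E w (\<phi>0 u)}\<rbrakk> \<Longrightarrow> \<exists>f\<in>arcs F. tail F f = u \<and> tag (\<phi>1 f) = i"
  using representation unfolding representation_graph_def by (metis in_out_arcs_conv)

lemma in_arc_exists:
  "\<lbrakk>u \<in> verts F; e \<in> arcs E; head E e = \<phi>0 u\<rbrakk> \<Longrightarrow> \<exists>f\<in>arcs F. head F f = u \<and> st (\<phi>1 f) = e"
  using representation unfolding representation_graph_def by (metis in_in_arcs_conv)

text \<open>The first condition on a representation graph gives uniqueness only for tags up to the weight of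
  the vertex; the tag of an existing edge is in that range.\<close>

lemma out_arc_unique:
  assumes "f \<in> arcs F" "f' \<in> arcs F" "tail F f = tail F f'" "tag (\<phi>1 f) = tag (\<phi>1 f')"
  shows "f = f'"
proof -
  have "tag (\<phi>1 f) \<in> {1..vertex_weight E w (\<phi>0 (tail F f))}"
    using arc_map[OF assms(1)] weight_le_vertex_weight[of "st (\<phi>1 f)"] by auto
  moreover have "\<forall>v\<in>verts F. \<forall>i\<in>{1..vertex_weight E w (\<phi>0 v)}. \<exists>!f. f \<in> out_arcs F v \<and> tag (\<phi>1 f) = i"
    using representation by (simp add: representation_graph_def)
  ultimately have "\<exists>!h. h \<in> out_arcs F (tail F f) \<and> tag (\<phi>1 h) = tag (\<phi>1 f)"
    using assms(1) F.tail_in_verts by blast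
  then show ?thesis
    using assms by (metis in_out_arcs_conv)
qed

lemma in_arc_unique:
  assumes "f \<in> arcs F" "f' \<in> arcs F" "head F f = head F f'" "st (\<phi>1 f) = st (\<phi>1 f')"
  shows "f = f'"
proof -
  have "st (\<phi>1 f) \<in> in_arcs E (\<phi>0 (head F f))"
    using arc_map[OF assms(1)] by simp
  moreover have "\<forall>v\<in>verts F. \<forall>e\<in>in_arcs E (\<phi>0 v). \<exists>!f. f \<in> in_arcs F v \<and> st (\<phi>1 f) = e"
    using representation by (simp add: representation_graph_def)
  ultimately have "\<exists>!h. h \<in> in_arcs F (head F f) \<and> st (\<phi>1 h) = st (\<phi>1 f)"
    using assms(1) F.head_in_verts by blast
  then show ?thesis
    using assms by (metis in_in_arcs_conv)
qed

lemma the_out_arc: "f \<in> arcs F \<Longrightarrow> (THE f'. f' \<in> out_arcs F (tail F f) \<and> \<phi>1 f' = \<phi>1 f) = f"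
  by (rule the_equality) (auto intro: out_arc_unique)

lemma the_in_arc: "f \<in> arcs F \<Longrightarrow> (THE f'. f' \<in> in_arcs F (head F f) \<and> \<phi>1 f' = \<phi>1 f) = f"
  by (rule the_equality) (auto intro: in_arc_unique)

text \<open>That \<open>\<phi>\<close> is a graph homomorphism makes the membership in \<open>D\<close> in the definitions of these sets
  automatic.\<close>

lemma R_iff: "u \<in> R a \<longleftrightarrow> (\<exists>f\<in>arcs F. tail F f = u \<and> \<phi>1 f = a)"
  using arc_map(4) by (auto simp: rep_R_def rep_D_def)

lemma De_iff: "u \<in> De a \<longleftrightarrow> (\<exists>f\<in>arcs F. head F f = u \<and> \<phi>1 f = a)"
  using arc_map(5) by (auto simp: rep_De_def rep_D_def)

lemma g_arc: "f \<in> arcs F \<Longrightarrow> g (\<phi>1 f) (tail F f) = head F f"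
  by (simp only: rep_g_def the_out_arc)

lemma g_graph: "u \<in> R a \<and> g a u = u' \<longleftrightarrow> (\<exists>f\<in>arcs F. tail F f = u \<and> head F f = u' \<and> \<phi>1 f = a)"
  by (auto simp: R_iff g_arc)

lemma g_image: "g a ` R a = De a"
  by (force simp: image_iff De_iff g_graph Bex_def conj_commute R_iff g_arc)

lemma R_arc_unique: "u \<in> R a \<Longrightarrow> \<exists>!f. f \<in> out_arcs F u \<and> \<phi>1 f = a"
  by (auto simp: R_iff intro: out_arc_unique)

lemma rep_g_inj: "inj_on (g a) (R a)"
proof (rule inj_onI)
  fix u v assume "u \<in> R a" "v \<in> R a" "g a u = g a v"
  then obtain f f' where "f \<in> arcs F" "tail F f = u" "\<phi>1 f = a" "head F f = g a v"
    and "f' \<in> arcs F" "tail F f' = v" "\<phi>1 f' = a" "head F f' = g a v"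
    by (metis g_graph)
  then show "u = v"
    using in_arc_unique[of f f'] by simp
qed

text \<open>Disjointness is uniqueness, and covering is existence, in the two conditions on a representation
  graph.\<close>

lemma representation_branching_system: "branching_system E w (verts F) R D g"
  unfolding branching_system_def g_image
proof (intro conjI ballI rep_g_inj)
  show "R a \<subseteq> verts F" for a
    by (auto simp: R_iff)
  show "D v \<subseteq> verts F" for v
    by (auto simp: rep_D_def)
  show "De a \<subseteq> D (head E (st a))" for a
    by (auto simp: rep_De_def)
  show "partition_family D (verts E) (verts F)"
    using vertex_map by (auto simp: partition_family_def disjoint_family_on_def rep_D_def)
next
  fix v i assume v: "v \<in> verts E" and i: "i \<in> {1..vertex_weight E w v}"
  have "R (e,i) \<inter> R (e',i) = {}" if "e \<noteq> e'" for e e'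
    using that by (auto simp: R_iff) (metis out_arc_unique fst_conv snd_conv)
  moreover have "\<exists>e. e \<in> arcs E \<and> tail E e = v \<and> i \<le> w e \<and> u \<in> R (e,i)" if u: "u \<in> D v" for u
  proof -
    obtain f where f: "f \<in> arcs F" "tail F f = u" "tag (\<phi>1 f) = i"
      using out_arc_exists[of u i] u i by (auto simp: rep_D_def)
    moreover have "\<phi>1 f = (st (\<phi>1 f), i)"
      using f by (simp add: prod_eq_iff)
    ultimately have "u \<in> R (st (\<phi>1 f), i)"
      unfolding R_iff by blast
    with f show ?thesis
      using arc_map[of f] u by (intro exI[of _ "st (\<phi>1 f)"]) (auto simp: rep_D_def)
  qed
  moreover have "R (e,i) \<subseteq> D (tail E e)" for e
    by (auto simp: rep_R_def)
  ultimately show "partition_family (\<lambda>e. R (e,i)) {e \<in> out_arcs E v. i \<le> w e} (D v)"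
    unfolding partition_family_def disjoint_family_on_def by (intro conjI; fastforce)
next
  fix e assume e: "e \<in> arcs E"
  have "De (e,i) \<inter> De (e,j) = {}" if "i \<noteq> j" for i j
    using that by (auto simp: De_iff) (metis in_arc_unique fst_conv snd_conv)
  moreover have "\<exists>i. 1 \<le> i \<and> i \<le> w e \<and> u \<in> De (e,i)" if u: "u \<in> D (head E e)" for u
  proof -
    obtain f where f: "f \<in> arcs F" "head F f = u" "st (\<phi>1 f) = e"
      using in_arc_exists[of u e] u e by (auto simp: rep_D_def)
    moreover have "\<phi>1 f = (e, tag (\<phi>1 f))"
      using f by (simp add: prod_eq_iff)
    ultimately have "u \<in> De (e, tag (\<phi>1 f))"
      unfolding De_iff by blast
    with f show ?thesis
      using arc_map[of f] by blast
  qed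
  moreover have "De (e,i) \<subseteq> D (head E e)" for i
    by (auto simp: rep_De_def)
  ultimately show "partition_family (\<lambda>i. De (e,i)) {1..w e} (D (head E e))"
    unfolding partition_family_def disjoint_family_on_def by (intro conjI; fastforce)
qed

sublocale weighted_branching_system E w "verts F" R D g
  by unfold_locales (rule representation_branching_system)

text \<open>The matrices of \<open>e\<^sub>i\<close> and \<open>e\<^sub>i\<^sup>*\<close> on the basis of vertices are transposes of each other, both given by
  the graph of the partial function \<open>g\<close>.\<close>

lemma lookup_basis_act_edge:
  "Poly_Mapping.lookup (VF_basis_act F \<phi>0 \<phi>1 v (Edge e i)) u =
    (if v \<in> R (e,i) \<and> g (e,i) v = u then 1 else (0::'k::field))"
  by (auto simp: R_iff lookup_single rep_g_def)

lemma lookup_basis_act_ghost: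
  "Poly_Mapping.lookup (VF_basis_act F \<phi>0 \<phi>1 v (Ghost e i)) u =
    (if u \<in> R (e,i) \<and> g (e,i) u = v then 1 else (0::'k::field))"
proof (cases "\<exists>f\<in>in_arcs F v. \<phi>1 f = (e,i)")
  case True
  then obtain f where f: "f \<in> arcs F" "head F f = v" "\<phi>1 f = (e,i)" by auto
  then have "(THE f. f \<in> in_arcs F v \<and> \<phi>1 f = (e,i)) = f"
    using the_in_arc[of f] by simp
  moreover have "u \<in> R (e,i) \<and> g (e,i) u = v \<longleftrightarrow> tail F f = u"
    unfolding g_graph using f by (auto dest: in_arc_unique)
  ultimately show ?thesis
    using True by (simp add: lookup_single when_def)
next
  case False
  then show ?thesis
    by (auto simp: g_graph)
qed

text \<open>In the sum expanding \<open>p.x\<close> at a vertex \<open>u\<close> at most one basis vertex contributes: \<open>u\<close> itself if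
  \<open>x\<close> is a vertex of \<open>E\<close>, the \<open>g\<close>-preimage of \<open>u\<close> if \<open>x = e\<^sub>i\<close>, and the \<open>g\<close>-image of \<open>u\<close> if \<open>x = e\<^sub>i\<^sup>*\<close>. These
  are the points at which the branching system evaluates.\<close>

lemma lookup_VF_gen_act:
  fixes p :: "'x \<Rightarrow>\<^sub>0 'k::field"
  assumes p: "p \<in> VF_space F"
  shows "Poly_Mapping.lookup (VF_gen_act F \<phi>0 \<phi>1 p x) = act (Poly_Mapping.lookup p) x"
proof
  fix u
  have sum: "Poly_Mapping.lookup (VF_gen_act F \<phi>0 \<phi>1 p x) u
    = (\<Sum>v\<in>Poly_Mapping.keys p. Poly_Mapping.lookup p v * Poly_Mapping.lookup (VF_basis_act F \<phi>0 \<phi>1 v x) u)"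
    by (simp add: VF_gen_act_def lookup_sum lookup_pm_scale)
  show "Poly_Mapping.lookup (VF_gen_act F \<phi>0 \<phi>1 p x) u = act (Poly_Mapping.lookup p) x u"
  proof (cases x)
    case (Vertex a)
    have "Poly_Mapping.lookup (VF_basis_act F \<phi>0 \<phi>1 v x) u =
        (if v = u then 1 else 0) * (if \<phi>0 u = a then 1 else (0::'k))" for v
      using Vertex by (auto simp: lookup_single when_def)
    then have "Poly_Mapping.lookup (VF_gen_act F \<phi>0 \<phi>1 p x) u =
        Poly_Mapping.lookup p u * (if \<phi>0 u = a then 1 else 0)"
      using lookup_sum_keys_if[of "\<lambda>v. v = u" u p]
      by (simp only: sum) (simp only: sum_distrib_right[symmetric] mult.assoc[symmetric])
    moreover have "Poly_Mapping.lookup p u = 0" if "u \<notin> verts F"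
      using p that by (auto simp: VF_space_def in_keys_iff)
    ultimately show ?thesis
      by (auto simp: Vertex rep_D_def)
  next
    case (Edge e i)
    let ?v = "inv_into (R (e,i)) (g (e,i)) u"
    have "v \<in> R (e,i) \<and> g (e,i) v = u \<longleftrightarrow> v = ?v" if "u \<in> g (e,i) ` R (e,i)" for v
      using inv_into_f_f[OF rep_g_inj, of v "(e,i)"] f_inv_into_f[OF that] inv_into_into[OF that] by metis
    then have "Poly_Mapping.lookup (VF_gen_act F \<phi>0 \<phi>1 p x) u = Poly_Mapping.lookup p ?v"
      if "u \<in> g (e,i) ` R (e,i)"
      using that lookup_sum_keys_if[of "\<lambda>v. v \<in> R (e,i) \<and> g (e,i) v = u" ?v p]
      by (simp only: sum) (simp only: Edge lookup_basis_act_edge)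
    moreover have "Poly_Mapping.lookup (VF_gen_act F \<phi>0 \<phi>1 p x) u = 0"
      if "u \<notin> g (e,i) ` R (e,i)"
    proof -
      have "\<not> (v \<in> R (e,i) \<and> g (e,i) v = u)" for v
        using that by blast
      then show ?thesis
        by (simp only: sum) (simp only: Edge lookup_basis_act_edge if_False mult_zero_right sum.neutral_const)
    qed
    ultimately show ?thesis
      by (simp add: Edge)
  next
    case (Ghost e i)
    have "Poly_Mapping.lookup (VF_gen_act F \<phi>0 \<phi>1 p x) u =
        (if u \<in> R (e,i) then Poly_Mapping.lookup p (g (e,i) u) else 0)"
      using lookup_sum_keys_if[of "\<lambda>v. g (e,i) u = v" "g (e,i) u" p, OF eq_commute]
      by (simp only: sum) (simp add: Ghost lookup_basis_act_ghost del: VF_basis_act.simps)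
    then show ?thesis
      by (simp add: Ghost)
  qed
qed

text \<open>The map is taken from functions to \<open>V\<^sub>F\<close> and not in the other direction because linearity and the
  relations are known for functions, and the source is where they are presupposed.\<close>

lemma generator_action_map_VF:
  "generator_action_map fun_scale (lpa_gens E w) (fin_supp_functions (verts F)) act
    pm_scale Abs_poly_mapping (VF_gen_act F \<phi>0 \<phi>1 :: ('x \<Rightarrow>\<^sub>0 'k::field) \<Rightarrow> _)"
proof -
  interpret M: relation_action "fun_scale :: 'k \<Rightarrow> _" "lpa_gens E w" "fin_supp_functions (verts F)" act "lpa_rels E w"
    by (rule relation_action_branching)
  show ?thesis
  proof unfold_locales
    fix \<theta> \<eta> :: "'x \<Rightarrow> 'k" and k x
    assume \<theta>: "\<theta> \<in> fin_supp_functions (verts F)"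
    show "Abs_poly_mapping (\<theta> + \<eta>) = Abs_poly_mapping \<theta> + Abs_poly_mapping \<eta>"
      if "\<eta> \<in> fin_supp_functions (verts F)"
      using function_space.subspace_add[OF M.subspace_M \<theta> that]
      by (intro poly_mapping_eqI) (simp add: lookup_add lookup_Abs_fin_supp[OF \<theta>] lookup_Abs_fin_supp[OF that] lookup_Abs_fin_supp)
    show "Abs_poly_mapping (fun_scale k \<theta>) = pm_scale k (Abs_poly_mapping \<theta>)"
      by (intro poly_mapping_eqI)
         (simp add: lookup_pm_scale lookup_Abs_fin_supp[OF \<theta>]
           lookup_Abs_fin_supp[OF function_space.subspace_scale[OF M.subspace_M \<theta>]],
          simp add: fun_scale_def)
    show "Abs_poly_mapping (act \<theta> x) = VF_gen_act F \<phi>0 \<phi>1 (Abs_poly_mapping \<theta>) x"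
      if "x \<in> lpa_gens E w"
    proof -
      have "Abs_poly_mapping \<theta> \<in> VF_space F"
        using \<theta> Abs_poly_mapping_image by blast
      then show ?thesis
        using M.gen_closed[OF \<theta> that] that
        by (intro poly_mapping_eqI) (simp add: lookup_VF_gen_act lookup_Abs_fin_supp[OF \<theta>] lookup_Abs_fin_supp)
    qed
  qed
qed

end


section \<open>Comparison of the two modules\<close>

theorem theorem55:
  fixes E :: "('v,'e) pre_digraph" and w :: "'e \<Rightarrow> nat"
    and F :: "('x,'f) pre_digraph" and \<phi>0 :: "'x \<Rightarrow> 'v" and \<phi>1 :: "'f \<Rightarrow> 'e \<times> nat"
    and L :: "('k::field, (('v,'e) lpa_gen fword \<Rightarrow>\<^sub>0 'k) set) algebra_ops"
    and X :: "'x set" and M0 :: "('x \<Rightarrow> 'k) set" and VF :: "('x \<Rightarrow>\<^sub>0 'k) set"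
  defines "L \<equiv> lpa E w"
    and "X \<equiv> verts F"
    and "D \<equiv> rep_D F \<phi>0"
    and "R \<equiv> rep_R E F \<phi>0 \<phi>1"
    and "De \<equiv> rep_De E F \<phi>0 \<phi>1"
    and "g \<equiv> rep_g F \<phi>1"
    and "M0 \<equiv> fin_supp_functions X"
    and "VF \<equiv> VF_space F"
  assumes "weighted_graph E w" and "representation_graph E w F \<phi>0 \<phi>1"
  shows "(\<forall>a\<in>arcs (hat_graph E w).
            (\<forall>u\<in>R a. \<exists>!f. f \<in> out_arcs F u \<and> \<phi>1 f = a) \<and> g a ` R a = De a)
    \<and> branching_system E w X R D g
    \<and> right_module L fun_scale M0 (branching_act R D g)
    \<and> (\<forall>\<theta>\<in>M0. \<forall>x\<in>lpa_gens E w.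
          branching_act R D g \<theta> (lpa_gen_elt E w x) = branching_gen_act R D g \<theta> x)
    \<and> right_module L pm_scale VF (VF_act F \<phi>0 \<phi>1)
    \<and> (\<forall>v\<in>verts F. \<forall>x\<in>lpa_gens E w.
          VF_act F \<phi>0 \<phi>1 (Poly_Mapping.single v (1::'k)) (lpa_gen_elt E w x) = VF_basis_act F \<phi>0 \<phi>1 v x)
    \<and> (\<exists>h. right_module_iso L fun_scale M0 (branching_act R D g) pm_scale VF (VF_act F \<phi>0 \<phi>1) h)"
proof -
  interpret weighted_representation_graph E w F \<phi>0 \<phi>1
    using assms(9,10) by (simp add: weighted_representation_graph_def weighted_representation_graph_axioms_def)
  interpret M: relation_action "fun_scale :: 'k \<Rightarrow> _" "lpa_gens E w" "fin_supp_functions (verts F)"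
      "branching_gen_act (rep_R E F \<phi>0 \<phi>1) (rep_D F \<phi>0) (rep_g F \<phi>1)" "lpa_rels E w"
    by (rule relation_action_branching)
  interpret h: generator_action_map "fun_scale :: 'k \<Rightarrow> _" "lpa_gens E w" "fin_supp_functions (verts F)"
      "branching_gen_act (rep_R E F \<phi>0 \<phi>1) (rep_D F \<phi>0) (rep_g F \<phi>1)"
      pm_scale Abs_poly_mapping "VF_gen_act F \<phi>0 \<phi>1"
    by (rule generator_action_map_VF)
  interpret V: relation_action "pm_scale :: 'k \<Rightarrow> _" "lpa_gens E w" "VF_space F"
      "VF_gen_act F \<phi>0 \<phi>1" "lpa_rels E w"
    using h.relation_action_image[OF M.relation_action_axioms] by (simp only: Abs_poly_mapping_image)
  have basis: "VF_act F \<phi>0 \<phi>1 (Poly_Mapping.single v (1::'k)) (lpa_gen_elt E w x) = VF_basis_act F \<phi>0 \<phi>1 v x"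
    if "v \<in> verts F" "x \<in> lpa_gens E w" for v x
  proof -
    have "Poly_Mapping.single v (1::'k) \<in> VF_space F"
      using that by (simp add: VF_space_def)
    then show ?thesis
      using that by (simp add: VF_act_def lpa_gen_elt_def V.quot_act_gen VF_gen_act_def pm_scale_one)
  qed
  have "right_module_iso L fun_scale M0 (branching_act R D g) pm_scale VF (VF_act F \<phi>0 \<phi>1) Abs_poly_mapping"
    using h.right_module_iso_image[OF M.relation_action_axioms inj_on_Abs_poly_mapping]
    by (simp only: Abs_poly_mapping_image branching_act_def VF_act_def assms(1-8))
  moreover have "right_module L pm_scale VF (VF_act F \<phi>0 \<phi>1)"
    using V.right_module_presented by (simp only: VF_act_def assms(1-8))
  moreover have "right_module L fun_scale M0 (branching_act R D g)"
    using M.right_module_presented by (simp only: branching_act_def assms(1-8))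
  moreover have "branching_act R D g \<theta> (lpa_gen_elt E w x) = branching_gen_act R D g \<theta> x"
    if "\<theta> \<in> M0" "x \<in> lpa_gens E w" for \<theta> x
    using that M.quot_act_gen by (simp only: branching_act_def lpa_gen_elt_def assms(1-8))
  moreover have "branching_system E w X R D g"
    using representation_branching_system by (simp only: assms(1-8))
  moreover have "\<exists>!f. f \<in> out_arcs F u \<and> \<phi>1 f = a" if "u \<in> R a" for u a
    using R_arc_unique that by (simp only: assms(1-8))
  moreover have "g a ` R a = De a" for a
    using g_image by (simp only: assms(1-8))
  ultimately show ?thesis
    using basis by blast
qed

end
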